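(* Let $A=\{t_n\}_{n=1}^\infty$ be a strictly increasing sequence of positive integers that dilates to infinity on a subsequence of positive lower density, i.e. there is a strictly increasing sequence $J=\{n_k\}_{k\ge1}\subseteq\mathbb{N}$ with lower density $\underline{d}(J)=\liminf_{n\to\infty}\frac{|J\cap[1,n]|}{n}>0$ such that $\lim_{k\to\infty}(t_{n_{k+1}}-t_{n_k})=+\infty$. Then there exists a rank one system $(X,\mathcal{B},\mu,T)$ such that $h^A(T)=+\infty$.
   Context: **Systems.** A measure-preserving system $(X,\mathcal{B},\mu,T)$ consists of a standard probability space and an invertible measure-preserving transformation $T$. Set equalities are modulo null sets. **Sequence entropy.** Let $f(0)=0$ and $f(x)=-x\log x$ for $x>0$. For a finite measurable partition $\xi=\{X_1,\dots,X_m\}$ put $H(\xi)=\sum_{i=1}^m f(\mu(X_i))$. For a sequence $A=\{t_n\}_{n\ge1}$ of non-negative integers put $$h^A(T,\xi)=\limsup_{n\to\infty}\frac1n H\Big(\bigvee_{k=1}^n T^{-t_k}\xi\Big),\qquad h^A(T)=\sup_\xi h^A(T,\xi),$$ the supremum being over all finite measurable partitions $\xi$ of $X$. **Rank one systems.** $(X,\mathcal{B},\mu,T)$ is a rank one system if there are integers $h_1\ge1$, $q_n\ge1$ ($n\ge1$) and $a_{n,i}\ge0$ ($n\ge1$, $1\le i\le q_n-1$) such that, with $a_n=\sum_{i=1}^{q_n-1}a_{n,i}$ and $h_{n+1}=q_nh_n+a_n$, the sequence $h_n$ is strictly increasing and $\sum_{n}a_n/h_{n+1}<\infty$, and measurable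 sets $F_n$ of positive measure such that for all $n\ge 1$: (a) $F_n,TF_n,\dots,T^{h_n-1}F_n$ are pairwise disjoint; their union is the tower $S_n$ with base $F_n$ and height $h_n$; (b) $F_n$ is partitioned into measurable sets $F_{n,1},\dots,F_{n,q_n}$; (c) $T^{h_n+a_{n,i}}F_{n,i}=F_{n,i+1}$ for $1\le i\le q_n-1$ (the sets $T^{h_n+j}F_{n,i}$, $0\le j<a_{n,i}$, are the spacer levels of $S_{n+1}$); (d) $F_{n+1}=F_{n,1}$; (e) the partitions $\xi_n=\{F_n,TF_n,\dots,T^{h_n-1}F_n,X\setminus S_n\}$ form a refining sequence converging to the partition into points (i.e. they generate $\mathcal{B}$ modulo null sets). *)

theory Defs
  imports "HOL-Probability.Probability"
begin

section \<open>Set relations modulo null sets\<close>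

definition ae_eq_set :: "'a measure \<Rightarrow> 'a set \<Rightarrow> 'a set \<Rightarrow> bool" where
  "ae_eq_set M A B \<longleftrightarrow> (A - B) \<union> (B - A) \<in> null_sets M"

definition ae_disjoint_family_on :: "'a measure \<Rightarrow> ('i \<Rightarrow> 'a set) \<Rightarrow> 'i set \<Rightarrow> bool" where
  "ae_disjoint_family_on M X I \<longleftrightarrow>
     (\<forall>i\<in>I. \<forall>j\<in>I. i \<noteq> j \<longrightarrow> X i \<inter> X j \<in> null_sets M)"

text \<open>Partitions are indexed families. Empty and null members are allowed; they do not
  contribute to entropy, since \<open>0 log 0 = 0\<close>.\<close>

definition ae_partition :: "'a measure \<Rightarrow> 'a set \<Rightarrow> 'i set \<Rightarrow> ('i \<Rightarrow> 'a set) \<Rightarrow> bool" where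
  "ae_partition M B I X \<longleftrightarrow>
     finite I \<and> (\<forall>i\<in>I. X i \<in> sets M) \<and>
     ae_disjoint_family_on M X I \<and> ae_eq_set M (\<Union>i\<in>I. X i) B"

section \<open>Measure-preserving systems\<close>

text \<open>A standard probability space is a probability measure on the Borel \<open>\<sigma>\<close>-algebra of
  some Polish topology on the underlying set.\<close>

definition standard_prob_space :: "'a measure \<Rightarrow> bool" where
  "standard_prob_space M \<longleftrightarrow>
     prob_space M \<and>
     (\<exists>P. topspace P = space M \<and> completely_metrizable_space P \<and> second_countable P \<and>
          sets M = sigma_sets (space M) {U. openin P U})"

definition mp_system :: "'a measure \<Rightarrow> ('a \<Rightarrow> 'a) \<Rightarrow> bool" where
  "mp_system M T \<longleftrightarrow>
     standard_prob_space M \<and>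
     bij_betw T (space M) (space M) \<and>
     T \<in> measurable M M \<and> the_inv_into (space M) T \<in> measurable M M \<and>
     distr M M T = M"

section \<open>Sequence entropy\<close>

definition ent_fun :: "real \<Rightarrow> real" where
  "ent_fun x = (if x = 0 then 0 else - x * ln x)"

definition part_entropy :: "'a measure \<Rightarrow> 'i set \<Rightarrow> ('i \<Rightarrow> 'a set) \<Rightarrow> real" where
  "part_entropy M I X = (\<Sum>i\<in>I. ent_fun (measure M (X i)))"

text \<open>The members of the join of \<open>T\<^sup>-\<^sup>t\<^sup>k\<xi>\<close>, \<open>k = 1, \<dots>, n\<close>, are indexed by the words
  \<open>w\<close> of length \<open>n\<close> over the index set of \<open>\<xi>\<close>. The value \<open>t 0\<close> is not used.\<close>

definition seq_join ::
  "'a measure \<Rightarrow> ('a \<Rightarrow> 'a) \<Rightarrow> (nat \<Rightarrow> nat) \<Rightarrow> ('i \<Rightarrow> 'a set) \<Rightarrow> nat \<Rightarrow> (nat \<Rightarrow> 'i) \<Rightarrow> 'a set"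
  where
  "seq_join M T t X n w = {x \<in> space M. \<forall>k\<in>{1..n}. (T ^^ t k) x \<in> X (w k)}"

definition seq_entropy_part ::
  "'a measure \<Rightarrow> ('a \<Rightarrow> 'a) \<Rightarrow> (nat \<Rightarrow> nat) \<Rightarrow> 'i set \<Rightarrow> ('i \<Rightarrow> 'a set) \<Rightarrow> ereal" where
  "seq_entropy_part M T t I X =
     limsup (\<lambda>n. ereal (part_entropy M ({1..n} \<rightarrow>\<^sub>E I) (seq_join M T t X n) / real n))"

definition seq_entropy :: "'a measure \<Rightarrow> ('a \<Rightarrow> 'a) \<Rightarrow> (nat \<Rightarrow> nat) \<Rightarrow> ereal" where
  "seq_entropy M T t =
     (SUP (m, X) \<in> {(m :: nat, X). ae_partition M (space M) {1..m} X}.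
        seq_entropy_part M T t {1..m} X)"

section \<open>Rank one systems\<close>

definition tower :: "('a \<Rightarrow> 'a) \<Rightarrow> 'a set \<Rightarrow> nat \<Rightarrow> 'a set" where
  "tower T F h = (\<Union>i<h. (T ^^ i) ` F)"

definition tower_partition :: "'a measure \<Rightarrow> ('a \<Rightarrow> 'a) \<Rightarrow> 'a set \<Rightarrow> nat \<Rightarrow> 'a set set" where
  "tower_partition M T F h = insert (space M - tower T F h) ((\<lambda>i. (T ^^ i) ` F) ` {..<h})"

definition ae_refines :: "'a measure \<Rightarrow> 'a set set \<Rightarrow> 'a set set \<Rightarrow> bool" where
  "ae_refines M Q P \<longleftrightarrow> (\<forall>C\<in>Q. \<exists>D\<in>P. C - D \<in> null_sets M)"

definition ae_generates :: "'a measure \<Rightarrow> 'a set set \<Rightarrow> bool" where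
  "ae_generates M G \<longleftrightarrow> (\<forall>B\<in>sets M. \<exists>B'\<in>sigma_sets (space M) G. ae_eq_set M B B')"

text \<open>Heights \<open>h\<close>, cuts \<open>q\<close> and spacers \<open>a\<close>; all stages are numbered from 1, so values at
  index 0 are not used.\<close>

definition rank_one_params ::
  "(nat \<Rightarrow> nat) \<Rightarrow> (nat \<Rightarrow> nat) \<Rightarrow> (nat \<Rightarrow> nat \<Rightarrow> nat) \<Rightarrow> bool" where
  "rank_one_params h q a \<longleftrightarrow>
     h 1 \<ge> 1 \<and> (\<forall>n\<ge>1. q n \<ge> 1) \<and>
     (\<forall>n\<ge>1. h (n + 1) = q n * h n + (\<Sum>i=1..q n - 1. a n i)) \<and>
     strict_mono_on {1..} h \<and>
     summable (\<lambda>n. real (\<Sum>i=1..q (n + 1) - 1. a (n + 1) i) / real (h (n + 2)))"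

definition rank_one_system :: "'a measure \<Rightarrow> ('a \<Rightarrow> 'a) \<Rightarrow> bool" where
  "rank_one_system M T \<longleftrightarrow>
     mp_system M T \<and>
     (\<exists>h q a F Fs. rank_one_params h q a \<and>
        (\<forall>n\<ge>1. F n \<in> sets M \<and> measure M (F n) > 0) \<and>
        (\<forall>n\<ge>1. ae_disjoint_family_on M (\<lambda>i. (T ^^ i) ` F n) {..<h n}) \<and>
        (\<forall>n\<ge>1. ae_partition M (F n) {1..q n} (Fs n)) \<and>
        (\<forall>n\<ge>1. \<forall>i\<in>{1..q n - 1}. ae_eq_set M ((T ^^ (h n + a n i)) ` Fs n i) (Fs n (i + 1))) \<and>
        (\<forall>n\<ge>1. ae_eq_set M (F (n + 1)) (Fs n 1)) \<and>
        (\<forall>n\<ge>1. ae_refines M (tower_partition M T (F (n + 1)) (h (n + 1)))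
                            (tower_partition M T (F n) (h n))) \<and>
        ae_generates M (\<Union>n\<in>{1..}. tower_partition M T (F n) (h n)))"

section \<open>Lower density\<close>

definition lower_density :: "nat set \<Rightarrow> ereal" where
  "lower_density J = liminf (\<lambda>n. ereal (real (card (J \<inter> {1..n})) / real n))"

text \<open>\<open>t\<close> dilates to infinity on a subsequence \<open>J = {s 1 < s 2 < \<dots>}\<close> of positive lower
  density.\<close>

definition dilates_on_positive_lower_density :: "(nat \<Rightarrow> nat) \<Rightarrow> bool" where
  "dilates_on_positive_lower_density t \<longleftrightarrow>
     (\<exists>s :: nat \<Rightarrow> nat. strict_mono_on {1..} s \<and> (\<forall>k\<ge>1. s k \<ge> 1) \<and>
        lower_density (s ` {1..}) > 0 \<and>
        filterlim (\<lambda>k. real (t (s (k + 1))) - real (t (s k))) at_top sequentially)"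

end

(* The system is built by cutting and stacking. The column of stage n + 1 consists of blocks, each
   containing many consecutive copies of the column C of stage n, shifted by a number r < h of
   spacers, where h is the height of C; the shifts run through all words of some length B. A random
   point of the tower therefore sees independent uniform shifts in different blocks. Along the
   subsequence the gaps of t eventually exceed the block length, so the times t k with k in a set K
   of positive density in {1..N} fall into distinct blocks, and the levels of C visited at these
   times are essentially independent and uniform. For the partition into the levels of a fixed
   column n0 and the rest, every cell fills at most a fraction 2^(-n0) of C. Hence, on a set of
   measure bounded below, every cell of the join has measure at most 2^(-n0 card K / 2), and the
   sequence entropy is at least a constant times n0. *)

theory Submission
  imports Defs
begin

section \<open>Counting in a column that enumerates all words of shifts\<close>

text \<open>Only part of the visited levels is under control: at offsets in
  \<open>{h..<L * h}\<close> a block shows a level of C whatever its shift is, but near its ends a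
  time may meet spacers. Averaging over starting heights in the first half of a group of
  \<open>B\<close> blocks shows that at least half of them see at least half of the times safely;
  this is where the exponent card K / 2 comes from. On safe times independence is exact, because the
  shifts are the digits of a number that runs through all of \<open>{..<h ^ B}\<close>. The
  partition is fixed while the stages advance. Stage m is designed for its own time set K only, and
  every partition coming from a column n \<le> m can use it, since each level of column m lies
  inside one cell. All cells must be small, the remainder too: heights at least double, and the
  spacers of stage n enlarge the mass by a factor of at most 1 + 2^(-(n+2)). The density constant
  does not depend on the block length, so K may be chosen once the height of C is known, and the
  number of blocks once K is known.\<close>

lemma card_prescribed_digits_le:
  fixes D :: "nat \<Rightarrow> nat set"
  assumes "\<forall>b<B. finite (D b)"
  shows "card {s. s < h ^ B \<and> (\<forall>b<B. s div h ^ b mod h \<in> D b)} \<le> (\<Prod>b<B. card (D b))"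
  using assms
proof (induction B arbitrary: D)
  case 0
  have "{s. s < h ^ 0 \<and> (\<forall>b<0. s div h ^ b mod h \<in> D b)} = {0::nat}" by auto
  then show ?case by simp
next
  case (Suc B)
  let ?S = "{s. s < h ^ Suc B \<and> (\<forall>b<Suc B. s div h ^ b mod h \<in> D b)}"
  let ?S' = "{s. s < h ^ B \<and> (\<forall>b<B. s div h ^ b mod h \<in> D (Suc b))}"
  have fin: "finite ?S'" by simp
  \<comment> \<open>The lowest digit is split off: digit \<open>b + 1\<close> of \<open>s\<close> is
    digit \<open>b\<close> of \<open>s div h\<close>, so the sets \<open>D (Suc b)\<close> govern
    the quotient.\<close>
  have inj: "inj_on (\<lambda>s. (s mod h, s div h)) ?S"
    by (rule inj_onI) (metis Pair_inject mult_div_mod_eq)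
  have im: "(\<lambda>s. (s mod h, s div h)) ` ?S \<subseteq> D 0 \<times> ?S'"
  proof
    fix y assume "y \<in> (\<lambda>s. (s mod h, s div h)) ` ?S"
    then obtain s where s: "s < h ^ Suc B" "\<And>b. b < Suc B \<Longrightarrow> s div h ^ b mod h \<in> D b"
      and y: "y = (s mod h, s div h)" by auto
    have "s mod h \<in> D 0" using s(2)[of 0] by simp
    moreover have "s div h < h ^ B"
      using s(1) by (simp add: less_mult_imp_div_less mult.commute)
    moreover have "s div h div h ^ b mod h \<in> D (Suc b)" if "b < B" for b
      using s(2)[of "Suc b"] that by (simp add: div_mult2_eq)
    ultimately show "y \<in> D 0 \<times> ?S'" using y by auto
  qed
  have "card ?S \<le> card (D 0 \<times> ?S')"
    using Suc.prems fin by (intro card_inj_on_le[OF inj im]) auto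
  also have "\<dots> = card (D 0) * card ?S'" by (simp add: card_cartesian_product)
  also have "\<dots> \<le> card (D 0) * (\<Prod>b<B. card (D (Suc b)))"
    using Suc.IH[of "\<lambda>b. D (Suc b)"] Suc.prems by auto
  also have "\<dots> = (\<Prod>b<Suc B. card (D b))" by (simp only: prod.lessThan_Suc_shift)
  finally show ?case .
qed

text \<open>Within a period of length \<open>G\<close> every residue occurs once, whatever the
  offset \<open>c\<close> is. This later bounds the number of offsets for which a given time meets
  the unsafe ends of a block.\<close>

lemma card_mod_in_shift:
  fixes G m c :: nat
  assumes "G > 0" "S \<subseteq> {..<G}"
  shows "card {j. j < m * G \<and> (j + c) mod G \<in> S} \<le> m * card S"
proof -
  have finS: "finite S" using assms(2) finite_subset by blast
  have inj: "inj_on (\<lambda>j. (j div G, (j + c) mod G)) {j. j < m * G \<and> (j + c) mod G \<in> S}"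
  proof (rule inj_onI)
    have le: "y \<le> x" if "x div G = y div G" "(x + c) mod G = (y + c) mod G" for x y
    proof (rule ccontr)
      assume xy: "\<not> y \<le> x"
      then have "G dvd (y + c) - (x + c)"
        using that(2) by (subst mod_eq_dvd_iff_nat[symmetric]) auto
      then have "G dvd y - x" by simp
      then have "y mod G = x mod G"
        using xy by (subst mod_eq_dvd_iff_nat) auto
      then have "y = x" using that(1) by (metis mult_div_mod_eq)
      then show False using xy by simp
    qed
    fix x y assume "(x div G, (x + c) mod G) = (y div G, (y + c) mod G)"
    then show "x = y" using le[of x y] le[of y x] by auto
  qed
  have "card {j. j < m * G \<and> (j + c) mod G \<in> S} \<le> card ({..<m} \<times> S)"
    using finS assms(1)
    by (intro card_inj_on_le[OF inj]) (auto simp: less_mult_imp_div_less)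
  then show ?thesis by (simp add: card_cartesian_product)
qed

text \<open>Given a column \<open>C\<close> of height \<open>h\<close>, the next column is \<open>C W\<^sub>0 W\<^sub>1 \<dots> C\<close>, where the block
  \<open>W\<^sub>m\<close> consists of \<open>r\<close> spacers, \<open>L\<close> copies of \<open>C\<close>, and \<open>h - r\<close> spacers, with
  \<open>r = block_shift h B m\<close>. Over the blocks with \<open>m div B = s\<close>, the numbers \<open>r\<close> are the base
  \<open>h\<close> digits of \<open>s\<close>, so all words in \<open>{..<h}\<^sup>B\<close> occur exactly once as \<open>s\<close> ranges over
  \<open>{..<h ^ B}\<close>.\<close>

definition block_shift :: "nat \<Rightarrow> nat \<Rightarrow> nat \<Rightarrow> nat" where
  "block_shift h B m = m div B div h ^ (m mod B) mod h"

definition block_len :: "nat \<Rightarrow> nat \<Rightarrow> nat" where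
  "block_len h L = (L + 1) * h"

definition copy_start :: "nat \<Rightarrow> nat \<Rightarrow> nat \<Rightarrow> nat \<Rightarrow> nat" where
  "copy_start h L B l = (if l = 0 then 0
     else h + (l - 1) div L * block_len h L + block_shift h B ((l - 1) div L) + (l - 1) mod L * h)"

definition copy_count :: "nat \<Rightarrow> nat \<Rightarrow> nat \<Rightarrow> nat" where
  "copy_count h L B = h ^ B * B * L + 2"

definition next_height :: "nat \<Rightarrow> nat \<Rightarrow> nat \<Rightarrow> nat" where
  "next_height h L B = 2 * h + h ^ B * B * block_len h L"

section \<open>Positions of the copies of a column inside the next one\<close>

lemma copy_start_0 [simp]: "copy_start h L B 0 = 0"
  by (simp add: copy_start_def)

lemma copy_start_in_block:
  assumes "l' < L"
  shows "copy_start h L B (Suc (m * L + l')) = h + m * block_len h L + block_shift h B m + l' * h"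
  using assms by (simp add: copy_start_def)

lemma copy_start_step:
  assumes "h > 0" "L > 0"
  shows "copy_start h L B l + h \<le> copy_start h L B (Suc l)"
proof (cases l)
  case 0
  then show ?thesis by (simp add: copy_start_def)
next
  case (Suc k)
  define m where "m = k div L"
  define l' where "l' = k mod L"
  have k: "k = m * L + l'" "l' < L" using assms by (auto simp: m_def l'_def)
  have r: "block_shift h B m < h" using assms by (simp add: block_shift_def)
  show ?thesis
  proof (cases "Suc l' < L")
    case True
    then have "copy_start h L B (Suc (Suc k)) =
      h + m * block_len h L + block_shift h B m + Suc l' * h"
      using copy_start_in_block[OF True, of h B m] k by simp
    then show ?thesis using copy_start_in_block[OF k(2), of h B m] k Suc by simp
  next
    case False
    then have L: "L = Suc l'" using k by simp
    have "copy_start h L B (Suc (Suc k)) =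
      h + Suc m * block_len h L + block_shift h B (Suc m)"
      using copy_start_in_block[of 0 L h B "Suc m"] k L by (simp add: algebra_simps)
    moreover have "block_len h L = l' * h + h + h" by (simp add: block_len_def L algebra_simps)
    ultimately show ?thesis using copy_start_in_block[OF k(2), of h B m] k(1) Suc r by simp
  qed
qed

lemma copy_start_last:
  assumes "L > 0" "B > 0"
  shows "copy_start h L B (copy_count h L B - 1) + h = next_height h L B"
proof -
  \<comment> \<open>The closing copy is formally the first copy of one more block, number
    \<open>h ^ B * B\<close>. Its shift is 0 since \<open>B > 0\<close> makes \<open>h\<close>
    divide \<open>h ^ B\<close>, so it starts exactly where the last block ends.\<close>
  have "block_shift h B (h ^ B * B) = 0"
    using assms by (simp add: block_shift_def)
  then show ?thesis
    using copy_start_in_block[of 0 L h B "h ^ B * B"] assms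
    by (simp add: copy_count_def next_height_def)
qed

text \<open>A block fits \<open>L\<close> copies into length \<open>(L + 1) * h\<close>, so over the
  blocks the ratio is exactly \<open>(L + 1) / L\<close>; the two outer copies bring no spacers and
  only improve it. This will keep the total measure finite.\<close>

lemma next_height_le:
  assumes "L > 0"
  shows "L * next_height h L B \<le> (L + 1) * (copy_count h L B * h)"
  by (simp add: next_height_def copy_count_def block_len_def algebra_simps)

text \<open>The copies occupy the offsets from \<open>r\<close> up to \<open>r + L * h\<close> with
  \<open>r < h\<close>, so offsets between \<open>h\<close> and \<open>L * h\<close> fall into a
  copy for every shift. The margin \<open>h \<le> o'\<close> also keeps the natural subtraction
  exact.\<close>

lemma copy_position_in_block:
  assumes h: "h > 0" and L: "L > 0" and m: "m < h ^ B * B"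
    and o: "h \<le> o'" "o' < L * h"
  shows "\<exists>l<copy_count h L B. h + m * block_len h L + o'
    = copy_start h L B l + (o' - block_shift h B m) mod h"
proof -
  let ?r = "block_shift h B m"
  have r: "?r < h" using h by (simp add: block_shift_def)
  define l' where "l' = (o' - ?r) div h"
  have l': "l' < L" using o by (auto simp: l'_def less_mult_imp_div_less)
  have "Suc (m * L + l') < copy_count h L B"
  proof -
    have "m * L + l' < Suc m * L" using l' by simp
    also have "\<dots> \<le> h ^ B * B * L" using m by (intro mult_right_mono) auto
    finally show ?thesis by (simp add: copy_count_def)
  qed
  moreover have "h + m * block_len h L + o'
    = copy_start h L B (Suc (m * L + l')) + (o' - ?r) mod h"
  proof -
    have "o' = ?r + (l' * h + (o' - ?r) mod h)" using r o by (simp add: l'_def)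
    then show ?thesis using copy_start_in_block[OF l', of h B m] by linarith
  qed
  ultimately show ?thesis by blast
qed

lemma block_shift_digit:
  assumes "b < B"
  shows "block_shift h B (s * B + b) = s div h ^ b mod h"
  using assms by (simp add: block_shift_def)

text \<open>Once \<open>j\<close> is fixed, time \<open>k\<close> meets block number
  \<open>b k\<close> of the group for every word, and the level seen there is
  \<open>(u k - d) mod h\<close> with \<open>d\<close> the digit number \<open>b k\<close> of
  \<open>s\<close>. Different digits \<open>d\<close> below \<open>h\<close> give different levels,
  so \<open>E k\<close> admits at most \<open>card (E k)\<close> digits. By the gaps, distinct times
  involve distinct digits, so the restrictions multiply.\<close>

lemma card_words_hitting_le:
  fixes t :: "nat \<Rightarrow> nat" and \<delta> :: real
  assumes h: "h > 0" and L: "L > 0" and finK: "finite K"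
    and gap: "\<And>k k'. k \<in> K \<Longrightarrow> k' \<in> K \<Longrightarrow> k < k' \<Longrightarrow> t k + block_len h L \<le> t k'"
    and inside: "\<And>k. k \<in> K \<Longrightarrow> j + t k < B * block_len h L"
    and good: "\<And>k. k \<in> K \<Longrightarrow> (j + t k) mod block_len h L \<in> {h..<L * h}"
    and E: "\<And>k. k \<in> K \<Longrightarrow> finite (E k) \<and> real (card (E k)) \<le> \<delta> * h"
  shows "real (card {s. s < h ^ B \<and> (\<forall>k\<in>K. \<forall>l p. l < copy_count h L B \<longrightarrow> p < h \<longrightarrow>
      h + s * (B * block_len h L) + j + t k = copy_start h L B l + p \<longrightarrow> p \<in> E k)})
    \<le> \<delta> ^ card K * real (h ^ B)" (is "real (card ?S) \<le> _")
proof -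
  define G where "G = block_len h L"
  have G: "G > 0" using h by (simp add: G_def block_len_def)
  define b where "b k = (j + t k) div G" for k
  define u where "u k = (j + t k) mod G" for k
  have bB: "b k < B" if "k \<in> K" for k
    using inside[OF that] by (simp add: b_def G_def less_mult_imp_div_less)
  have u: "h \<le> u k" "u k < L * h" if "k \<in> K" for k
    using good[OF that] by (auto simp: u_def G_def)
  have b_less: "b k < b k'" if "k \<in> K" "k' \<in> K" "k < k'" for k k'
  proof -
    have "(j + t k + G) div G \<le> b k'"
      unfolding b_def using gap[OF that] by (intro div_le_mono) (simp add: G_def)
    then show ?thesis using G by (simp add: b_def)
  qed
  have injb: "inj_on b K"
    by (rule inj_onI) (metis b_less less_irrefl linorder_neqE_nat)
  define D where "D k = {d. d < h \<and> (u k - d) mod h \<in> E k}" for k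
  have cardD: "card (D k) \<le> card (E k)" if k: "k \<in> K" for k
  proof (rule card_inj_on_le)
    show "inj_on (\<lambda>d. (u k - d) mod h) (D k)"
    proof (rule inj_onI)
      fix x y assume xy: "x \<in> D k" "y \<in> D k" and eq: "(u k - x) mod h = (u k - y) mod h"
      have aux: "x = y" if "x \<le> y" "y < h" "(u k - x) mod h = (u k - y) mod h" for x y
      proof -
        have "u k - y \<le> u k - x" using that by simp
        then have "h dvd (u k - x) - (u k - y)" using that(3) by (metis mod_eq_dvd_iff_nat)
        moreover have "(u k - x) - (u k - y) = y - x" using that u(1)[OF k] by simp
        ultimately have "h dvd y - x" by simp
        then show "x = y" using that by (metis diff_le_self dvd_imp_le le_less_trans not_le
              diff_is_0_eq le_antisym zero_less_iff_neq_zero leD)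
      qed
      show "x = y" using xy eq aux[of x y] aux[of y x] by (cases "x \<le> y") (auto simp: D_def)
    qed
  qed (use E[OF k] in \<open>auto simp: D_def\<close>)
  \<comment> \<open>Blocks met by no time leave their digit free; their full factors
    \<open>h\<close> turn the product into a proportion of \<open>h ^ B\<close>.\<close>
  define D' where "D' i = (if i \<in> b ` K then D (the_inv_into K b i) else {..<h})" for i
  have D'b: "D' (b k) = D k" if "k \<in> K" for k
    using that injb by (simp add: D'_def the_inv_into_f_f)
  have finD: "finite (D k)" for k by (simp add: D_def)
  have finD': "finite (D' i)" for i by (simp add: D'_def finD)
  have sub: "?S \<subseteq> {s. s < h ^ B \<and> (\<forall>i<B. s div h ^ i mod h \<in> D' i)}"
  proof safe
    fix s i assume s: "s < h ^ B" and i: "i < B"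
      and *: "\<forall>k\<in>K. \<forall>l p. l < copy_count h L B \<longrightarrow> p < h \<longrightarrow>
        h + s * (B * block_len h L) + j + t k = copy_start h L B l + p \<longrightarrow> p \<in> E k"
    show "s div h ^ i mod h \<in> D' i"
    proof (cases "i \<in> b ` K")
      case True
      then obtain k where k: "k \<in> K" "i = b k" by auto
      define m where "m = s * B + i"
      have "m < Suc s * B" using i by (simp add: m_def)
      also have "\<dots> \<le> h ^ B * B" using s by (intro mult_right_mono) auto
      finally have m: "m < h ^ B * B" .
      have sh: "block_shift h B m = s div h ^ i mod h" unfolding m_def by (rule block_shift_digit[OF i])
      have "j + t k = i * G + u k" using k by (simp add: b_def u_def)
      then have "h + s * (B * block_len h L) + j + t k = h + m * block_len h L + u k"
        by (simp add: m_def G_def algebra_simps)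
      then obtain l where "l < copy_count h L B"
        "h + s * (B * block_len h L) + j + t k = copy_start h L B l + (u k - block_shift h B m) mod h"
        using copy_position_in_block[OF h L m u[OF k(1)]] by auto
      then have "(u k - block_shift h B m) mod h \<in> E k" using * k(1) h by simp
      then show ?thesis using k D'b h by (simp add: D_def sh)
    next
      case False
      then show ?thesis using h by (simp add: D'_def)
    qed
  qed
  have split: "(\<Prod>i<B. real (card (D' i))) = (\<Prod>k\<in>K. real (card (D k))) * real h ^ (B - card K)"
  proof -
    have bK: "b ` K \<subseteq> {..<B}" using bB by auto
    have "(\<Prod>i<B. real (card (D' i)))
      = (\<Prod>i\<in>{..<B} - b ` K. real (card (D' i))) * (\<Prod>i\<in>b ` K. real (card (D' i)))"
      by (rule prod.subset_diff[OF bK]) simp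
    also have "(\<Prod>i\<in>b ` K. real (card (D' i))) = (\<Prod>k\<in>K. real (card (D k)))"
      using D'b by (simp add: prod.reindex[OF injb])
    also have "(\<Prod>i\<in>{..<B} - b ` K. real (card (D' i))) = (\<Prod>i\<in>{..<B} - b ` K. real h)"
      by (intro prod.cong) (auto simp: D'_def)
    also have "\<dots> = real h ^ (B - card K)"
      using bK finK by (simp add: card_Diff_subset card_image[OF injb])
    finally show ?thesis by (simp add: mult.commute)
  qed
  have KB: "card K \<le> B"
    using card_inj_on_le[OF injb, of "{..<B}"] bB by auto
  have "card ?S \<le> card {s. s < h ^ B \<and> (\<forall>i<B. s div h ^ i mod h \<in> D' i)}"
    by (rule card_mono[OF _ sub]) simp
  also have "\<dots> \<le> (\<Prod>i<B. card (D' i))"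
    by (rule card_prescribed_digits_le) (simp add: finD')
  finally have "real (card ?S) \<le> real (\<Prod>i<B. card (D' i))" by (simp only: of_nat_le_iff)
  also have "\<dots> = (\<Prod>k\<in>K. real (card (D k))) * real h ^ (B - card K)"
    using split by simp
  also have "\<dots> \<le> (\<Prod>k\<in>K. \<delta> * h) * real h ^ (B - card K)"
  proof (intro mult_right_mono prod_mono conjI)
    fix k assume "k \<in> K"
    then show "real (card (D k)) \<le> \<delta> * h" using cardD[of k] E[of k] by linarith
  qed auto
  also have "\<dots> = \<delta> ^ card K * (real h ^ card K * real h ^ (B - card K))"
    by (simp add: power_mult_distrib)
  also have "real h ^ card K * real h ^ (B - card K) = real (h ^ B)"
    using KB by (simp flip: power_add)
  finally show ?thesis .
qed

text \<open>For \<open>i\<close> uniformly distributed in \<open>Y\<close>, the levels of \<open>C\<close> found at the heights \<open>i + t k\<close>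
  behave like at least \<open>card K / 2\<close> independent uniformly distributed ones.\<close>

definition independent_positions :: "(nat \<Rightarrow> nat) \<Rightarrow> nat set \<Rightarrow> nat \<Rightarrow> nat \<Rightarrow> nat \<Rightarrow> nat set \<Rightarrow> bool" where
  "independent_positions t K h L B Y \<longleftrightarrow>
    (\<forall>i\<in>Y. \<forall>k\<in>K. i + t k < next_height h L B) \<and> Y \<subseteq> {..<next_height h L B}
    \<and> next_height h L B \<le> 8 * card Y
    \<and> (\<forall>(\<delta> :: real) (E :: nat \<Rightarrow> nat set). 0 < \<delta> \<longrightarrow> \<delta> \<le> 1 \<longrightarrow> (\<forall>k\<in>K. finite (E k) \<and> real (card (E k)) \<le> \<delta> * h) \<longrightarrow>
      real (card {i \<in> Y. \<forall>k\<in>K. \<forall>l p. l < copy_count h L B \<longrightarrow> p < h \<longrightarrow>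
        i + t k = copy_start h L B l + p \<longrightarrow> p \<in> E k})
      \<le> \<delta> powr (card K / 2) * next_height h L B)"

text \<open>Double counting of pairs of an offset \<open>j\<close> and a time \<open>k\<close>. The
  unsafe ends have total length \<open>2 * h\<close> in a block of length at least
  \<open>8 * h\<close>, so each time is unsafe for at most a quarter of the offsets, and at most
  half of the offsets have more than half of their times unsafe. The remaining offsets, taken in
  every group, form \<open>Y\<close>.\<close>

lemma many_independent_positions:
  fixes t :: "nat \<Rightarrow> nat"
  assumes h: "h > 0" and L: "L \<ge> 7" and finK: "finite K" and K: "K \<noteq> {}" and B: "B = 2 * B'" "B' > 0"
    and gap: "\<And>k k'. k \<in> K \<Longrightarrow> k' \<in> K \<Longrightarrow> k < k' \<Longrightarrow> t k + block_len h L \<le> t k'"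
    and bound: "\<And>k. k \<in> K \<Longrightarrow> t k < B' * block_len h L"
  shows "\<exists>Y. independent_positions t K h L B Y"
proof -
  define G where "G = block_len h L"
  have G: "G = (L + 1) * h" "G > 0" using h by (auto simp: G_def block_len_def)
  define R where "R = h ^ B"
  have R: "R > 0" using h by (simp add: R_def)
  have nh: "next_height h L B = 2 * h + R * (B * G)" by (simp add: next_height_def R_def G_def)
  define bad where "bad = {..<h} \<union> {L * h..<G}"
  have "card bad \<le> card {..<h} + card {L * h..<G}" unfolding bad_def by (rule card_Un_le)
  then have card_bad: "card bad \<le> 2 * h" by (simp add: G algebra_simps)
  have bad_sub: "bad \<subseteq> {..<G}" using L h by (auto simp: bad_def G)
  define good where "good j = {k \<in> K. (j + t k) mod G \<in> {h..<L * h}}" for j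
  have good_sub: "good j \<subseteq> K" for j by (auto simp: good_def)
  have Kgood: "K - good j = {k \<in> K. (j + t k) mod G \<in> bad}" for j
    using G by (auto simp: good_def bad_def)
  \<comment> \<open>Offsets run over the first half of a group of \<open>2 * B'\<close> blocks, so
    that adding \<open>t k < B' * G\<close> stays in the group and is governed by a single word
    \<open>s\<close>.\<close>
  define J where "J = {j. j < B' * G \<and> card K \<le> 2 * card (good j)}"
  define N where "N = {..<B' * G} - J"
  have finN: "finite N" and finJ: "finite J" by (auto simp: N_def J_def)
  have "card N * card K \<le> (\<Sum>j\<in>N. 2 * card (K - good j))"
  proof -
    have "card N * card K = (\<Sum>j\<in>N. card K)" by simp
    also have "\<dots> \<le> (\<Sum>j\<in>N. 2 * card (K - good j))"
    proof (rule sum_mono)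
      fix j assume "j \<in> N"
      then have "2 * card (good j) < card K" by (auto simp: N_def J_def)
      then show "card K \<le> 2 * card (K - good j)"
        using card_Diff_subset[OF finite_subset[OF good_sub finK] good_sub, of j] by simp
    qed
    finally show ?thesis .
  qed
  also have "\<dots> \<le> (\<Sum>j<B' * G. 2 * card (K - good j))"
    by (rule sum_mono2) (auto simp: N_def)
  also have "\<dots> = 2 * (\<Sum>j<B' * G. \<Sum>k\<in>K. if (j + t k) mod G \<in> bad then 1 else 0)"
    using finK by (simp add: Kgood sum_distrib_left sum.If_cases Int_def)
  also have "(\<Sum>j<B' * G. \<Sum>k\<in>K. if (j + t k) mod G \<in> bad then 1 else 0)
      = (\<Sum>k\<in>K. \<Sum>j<B' * G. if (j + t k) mod G \<in> bad then 1 else 0)"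
    by (rule sum.swap)
  also have "\<dots> = (\<Sum>k\<in>K. card {j. j < B' * G \<and> (j + t k) mod G \<in> bad})"
    by (simp add: sum.If_cases Int_def)
  also have "\<dots> \<le> (\<Sum>k\<in>K. B' * card bad)"
    by (intro sum_mono card_mod_in_shift G bad_sub)
  also have "2 * \<dots> \<le> 2 * (\<Sum>k\<in>K. B' * (2 * h))"
    using card_bad by (intro mult_left_mono sum_mono) auto
  also have "\<dots> = 4 * B' * h * card K" by simp
  finally have cN: "card N \<le> 4 * B' * h" using K finK by (simp add: card_gt_0_iff)
  have "card J = B' * G - card N"
  proof -
    have "J = {..<B' * G} - N" by (auto simp: N_def J_def)
    moreover have "N \<subseteq> {..<B' * G}" by (auto simp: N_def)
    ultimately show ?thesis using finN by (simp add: card_Diff_subset)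
  qed
  then have "2 * card J \<ge> 2 * (B' * G) - 8 * (B' * h)" using cN by simp
  moreover have "8 * (B' * h) \<le> B' * G" using L by (simp add: G)
  ultimately have cJ: "B' * G \<le> 2 * card J" by linarith
  define \<phi> where "\<phi> = (\<lambda>(s, j). h + s * (B * G) + j)"
  define Y where "Y = \<phi> ` ({..<R} \<times> J)"
  have BG: "j < B' * G \<Longrightarrow> j < B * G" for j by (simp add: B)
  have inj: "inj_on \<phi> ({..<R} \<times> J)"
  proof (rule inj_onI)
    fix x y assume xy: "x \<in> {..<R} \<times> J" "y \<in> {..<R} \<times> J" and e: "\<phi> x = \<phi> y"
    obtain s j s' j' where [simp]: "x = (s, j)" "y = (s', j')" by fastforce
    have j: "j < B * G" "j' < B * G" using xy BG by (auto simp: J_def)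
    have e: "s * (B * G) + j = s' * (B * G) + j'" using e by (simp add: \<phi>_def)
    have div: "(a * c + r) div c = a" if "r < c" for a c r :: nat
    proof -
      have "c \<noteq> 0" using that by simp
      then have "(a * c + r) div c = a + r div c" by (rule div_mult_self3)
      then show ?thesis using that by simp
    qed
    have "s = (s * (B * G) + j) div (B * G)" by (rule div[OF j(1), symmetric])
    also have "\<dots> = s'" unfolding e by (rule div[OF j(2)])
    finally have "s = s'" .
    then show "x = y" using e by simp
  qed
  have finY: "finite Y" using finJ by (simp add: Y_def)
  have top: "h + s * (B * G) + j + t k < next_height h L B" if "s < R" "j \<in> J" "k \<in> K" for s j k
  proof -
    have "j + t k < B * G" using that bound[of k] by (auto simp: J_def B G_def)
    then have "s * (B * G) + (j + t k) < Suc s * (B * G)" by simp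
    also have "\<dots> \<le> R * (B * G)" using that by (intro mult_right_mono) auto
    finally show ?thesis by (simp add: nh)
  qed
  have cY: "card Y = R * card J" by (simp add: Y_def card_image[OF inj] card_cartesian_product)
  have hR: "2 * h \<le> R * (B * G)"
  proof -
    have "1 * ((2 * 1) * (1 * h)) \<le> R * ((2 * B') * ((L + 1) * h))"
      using R B by (intro mult_le_mono) auto
    then show ?thesis by (simp add: B G)
  qed
  show ?thesis
    unfolding independent_positions_def
  proof (intro exI[of _ Y] conjI ballI allI impI)
    fix i k assume "i \<in> Y" "k \<in> K"
    then show "i + t k < next_height h L B" using top by (auto simp: Y_def \<phi>_def)
  next
    obtain k where k: "k \<in> K" using K by auto
    show "Y \<subseteq> {..<next_height h L B}" using top[OF _ _ k] add_lessD1
      by (fastforce simp: Y_def \<phi>_def)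
  next
    \<comment> \<open>\<open>Y\<close> holds at least half of the first halves of the groups, a
      quarter of all block positions. The two outer copies cost at most another factor 2, which
      gives 8.\<close>
    have "R * (B' * G) \<le> R * (2 * card J)" using cJ by (rule mult_left_mono) simp
    moreover have "next_height h L B = 2 * h + 2 * (R * (B' * G))" "h \<le> R * (B' * G)"
      using hR unfolding nh by (simp_all add: B)
    ultimately show "next_height h L B \<le> 8 * card Y" unfolding cY by linarith
  next
    fix \<delta> :: real and E :: "nat \<Rightarrow> nat set" assume \<delta>: "0 < \<delta>" "\<delta> \<le> 1"
      and E: "\<forall>k\<in>K. finite (E k) \<and> real (card (E k)) \<le> \<delta> * h"
    define hit where "hit i k \<longleftrightarrow> (\<forall>l p. l < copy_count h L B \<longrightarrow> p < h \<longrightarrow>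
        i + t k = copy_start h L B l + p \<longrightarrow> p \<in> E k)" for i k
    define S where "S j = {s. s < R \<and> (\<forall>k\<in>good j. hit (h + s * (B * G) + j) k)}" for j
    have S: "real (card (S j)) \<le> \<delta> powr (card K / 2) * R" if j: "j \<in> J" for j
    proof -
      have "real (card (S j)) \<le> \<delta> ^ card (good j) * R"
        unfolding S_def hit_def R_def G_def
      proof (rule card_words_hitting_le)
        show "h > 0" "L > 0" using h L by auto
        show "finite (good j)" using finite_subset[OF good_sub finK] .
        fix k assume k: "k \<in> good j"
        show "j + t k < B * block_len h L"
        proof -
          have "k \<in> K" using k good_sub by auto
          then have "t k < B' * G" "j < B' * G" using bound j by (auto simp: J_def G_def)
          then have "j + t k < B * G" by (simp add: B)
          then show ?thesis by (simp add: G_def)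
        qed
        show "(j + t k) mod block_len h L \<in> {h..<L * h}" using k by (simp add: good_def G_def)
        show "finite (E k) \<and> real (card (E k)) \<le> \<delta> * real h" using E k good_sub by auto
      next
        fix k k' assume "k \<in> good j" "k' \<in> good j" "k < k'"
        then show "t k + block_len h L \<le> t k'" using gap good_sub by blast
      qed
      \<comment> \<open>Unsafe times impose no condition here; at least half of \<open>K\<close> is
        left, and \<open>\<delta> \<le> 1\<close> makes the smaller exponent the weaker
        bound.\<close>
      also have "\<delta> ^ card (good j) \<le> \<delta> powr (card K / 2)"
      proof -
        have "\<delta> ^ card (good j) = \<delta> powr card (good j)" using \<delta> by (simp add: powr_realpow)
        also have "\<dots> \<le> \<delta> powr (card K / 2)"
          using j \<delta> by (intro powr_mono') (auto simp: J_def)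
        finally show ?thesis .
      qed
      finally show ?thesis by (simp add: mult_right_mono)
    qed
    have "card {i \<in> Y. \<forall>k\<in>K. hit i k} \<le> card (\<phi> ` (\<lambda>(j, s). (s, j)) ` (SIGMA j:J. S j))"
    proof (rule card_mono)
      show "finite (\<phi> ` (\<lambda>(j, s). (s, j)) ` (SIGMA j:J. S j))"
        using finJ by (auto simp: S_def)
      show "{i \<in> Y. \<forall>k\<in>K. hit i k} \<subseteq> \<phi> ` (\<lambda>(j, s). (s, j)) ` (SIGMA j:J. S j)"
      proof
        fix i assume "i \<in> {i \<in> Y. \<forall>k\<in>K. hit i k}"
        then obtain s j where "s < R" "j \<in> J" "i = \<phi> (s, j)" "\<forall>k\<in>K. hit i k"
          by (auto simp: Y_def)
        then have "j \<in> J" "s \<in> S j" "i = \<phi> ((\<lambda>(j, s). (s, j)) (j, s))"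
          using good_sub by (auto simp: S_def \<phi>_def)
        then show "i \<in> \<phi> ` (\<lambda>(j, s). (s, j)) ` (SIGMA j:J. S j)" by blast
      qed
    qed
    also have "\<dots> \<le> card (SIGMA j:J. S j)"
      using finJ by (simp only: image_image) (rule card_image_le, auto simp: S_def)
    also have "\<dots> = (\<Sum>j\<in>J. card (S j))"
      using finJ by (intro card_SigmaI) (auto simp: S_def)
    finally have "real (card {i \<in> Y. \<forall>k\<in>K. hit i k}) \<le> (\<Sum>j\<in>J. real (card (S j)))"
      by (simp flip: of_nat_sum)
    also have "\<dots> \<le> (\<Sum>j\<in>J. \<delta> powr (card K / 2) * R)" by (intro sum_mono S)
    also have "\<dots> = \<delta> powr (card K / 2) * (R * card J)" by simp
    also have "\<dots> \<le> \<delta> powr (card K / 2) * next_height h L B"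
    proof (rule mult_left_mono)
      have "card J \<le> B' * G" using card_mono[of "{..<B' * G}" J] by (auto simp: J_def)
      then have "R * card J \<le> R * (B * G)" by (intro mult_left_mono) (auto simp: B)
      then have "R * card J \<le> next_height h L B" unfolding nh by linarith
      then show "real (R * card J) \<le> real (next_height h L B)" by (simp only: of_nat_le_iff)
    qed simp
    finally show "real (card {i \<in> Y. \<forall>k\<in>K. \<forall>l p. l < copy_count h L B \<longrightarrow> p < h \<longrightarrow>
        i + t k = copy_start h L B l + p \<longrightarrow> p \<in> E k}) \<le> \<delta> powr (card K / 2) * next_height h L B"
      by (simp add: hit_def)
  qed
qed

section \<open>Density and entropy\<close>

text \<open>Gaps below \<open>G\<close> occur only in an initial segment. Dropping it costs a
  bounded number of indices, hence at most half of the density once \<open>N\<close> is large. So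
  \<open>d\<close> is half of a lower bound for the density and independent of \<open>G\<close> and
  \<open>m\<close>.\<close>

lemma sparse_times:
  assumes "dilates_on_positive_lower_density t"
  shows "\<exists>d>0. \<forall>G m. \<exists>N\<ge>m. \<exists>K\<subseteq>{1..N}. N > 0 \<and> d * real N \<le> real (card K)
    \<and> (\<forall>k\<in>K. \<forall>k'\<in>K. k < k' \<longrightarrow> t k + G \<le> t k')"
proof -
  obtain s :: "nat \<Rightarrow> nat" where s: "strict_mono_on {1..} s" "\<And>k. k \<ge> 1 \<Longrightarrow> s k \<ge> 1"
    and dens: "lower_density (s ` {1..}) > 0"
    and lim: "filterlim (\<lambda>k. real (t (s (k + 1))) - real (t (s k))) at_top sequentially"
    using assms unfolding dilates_on_positive_lower_density_def by blast
  define J where "J = s ` {1..}"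
  obtain e' :: ereal where e': "0 < e'" "e' < lower_density J"
    using dens unfolding J_def using dense by blast
  obtain e :: real where e: "0 < e" "ereal e < lower_density J"
    using e' by (cases e') auto
  have ev: "\<forall>\<^sub>F n in sequentially. ereal e < ereal (real (card (J \<inter> {1..n})) / real n)"
    using e(2) unfolding lower_density_def by (rule less_LiminfD)
  then obtain n0 where n0: "\<And>n. n \<ge> n0 \<Longrightarrow> e < real (card (J \<inter> {1..n})) / real n"
    unfolding eventually_sequentially by auto
  have "\<exists>N\<ge>m. \<exists>K\<subseteq>{1..N}. N > 0 \<and> e / 2 * real N \<le> real (card K)
    \<and> (\<forall>k\<in>K. \<forall>k'\<in>K. k < k' \<longrightarrow> t k + G \<le> t k')" for G m
  proof -
    obtain k0 where k0: "\<And>k. k \<ge> k0 \<Longrightarrow> real G \<le> real (t (s (k + 1))) - real (t (s k))"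
      using lim unfolding filterlim_at_top eventually_sequentially by meson
    \<comment> \<open>The maximum with 1 keeps all later indices in the range where \<open>s\<close>
      is increasing.\<close>
    define c where "c = max 1 k0"
    have step: "t (s k) + G \<le> t (s (k + 1))" if "k \<ge> c" for k
      using k0[of k] that by (simp add: c_def)
    have mono: "t (s c') + G \<le> t (s (c' + Suc i))" if "c' \<ge> c" for c' i
    proof (induction i)
      case 0
      then show ?case using step[of c'] that by simp
    next
      case (Suc i)
      then show ?case using step[of "c' + Suc i"] that by simp
    qed
    obtain M :: nat where M: "real c + 1 \<le> e / 2 * real M"
      using reals_Archimedean3[of "e / 2"] e by (metis half_gt_zero less_imp_le mult.commute)
    define N where "N = m + n0 + M + 1"
    define K where "K = J \<inter> {1..N} - s ` {..c}"
    have "e * real N < real (card (J \<inter> {1..N}))"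
      using n0[of N] by (simp add: N_def field_simps)
    moreover have "card (J \<inter> {1..N}) \<le> card K + (c + 1)"
    proof -
      have "card (J \<inter> {1..N}) - card (s ` {..c}) \<le> card K"
        unfolding K_def by (rule diff_card_le_card_Diff) simp
      moreover have "card (s ` {..c}) \<le> c + 1" using card_image_le[of "{..c}" s] by simp
      ultimately show ?thesis by simp
    qed
    ultimately have "e * real N \<le> real (card K) + real c + 1" by linarith
    moreover have "real c + 1 \<le> e / 2 * real N"
      using M e by (smt (verit) N_def mult_left_mono of_nat_le_iff le_add1 le_add2 add.assoc trans_le_add1 half_gt_zero)
    ultimately have cK: "e / 2 * real N \<le> real (card K)" by simp
    have "t k + G \<le> t k'" if "k \<in> K" "k' \<in> K" "k < k'" for k k'
    proof -
      have *: "\<exists>i>c. x = s i" if "x \<in> K" for x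
      proof -
        obtain i where "x = s i" using \<open>x \<in> K\<close> by (auto simp: K_def J_def)
        moreover have "i > c" using \<open>x \<in> K\<close> \<open>x = s i\<close> by (intro not_le_imp_less) (auto simp: K_def)
        ultimately show ?thesis by blast
      qed
      obtain i i' where i: "k = s i" "k' = s i'" "i > c" "i' > c"
        using *[OF \<open>k \<in> K\<close>] *[OF \<open>k' \<in> K\<close>] by blast
      have "i < i'"
      proof (rule ccontr)
        assume "\<not> i < i'"
        then have "s i' \<le> s i"
          using s(1) i by (cases "i = i'") (auto simp: strict_mono_on_def c_def intro!: less_imp_le)
        then show False using that i by simp
      qed
      then show ?thesis using mono[of i "i' - Suc i"] i by simp
    qed
    moreover have "K \<subseteq> {1..N}" by (auto simp: K_def)
    ultimately show ?thesis using cK by (intro exI[of _ N]) (auto simp: N_def)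
  qed
  then show ?thesis using e(1) by (meson half_gt_zero)
qed

text \<open>Fewer than \<open>\<eta> / p\<close> cells have measure above \<open>p / \<eta>\<close>, so these cover at most \<open>\<eta>\<close> of \<open>Y\<close>; on the
  remaining cells \<open>- ln\<close> of the measure is at least \<open>ln (\<eta> / p)\<close>.\<close>

lemma part_entropy_ge:
  assumes "prob_space M" and I: "finite I"
    and A: "\<And>i. i \<in> I \<Longrightarrow> A i \<in> sets M" and Y: "Y \<in> sets M"
    and cover: "Y \<subseteq> (\<Union>i\<in>I. A i)" and disj: "ae_disjoint_family_on M A I"
    and sub: "\<And>i. i \<in> I \<Longrightarrow> measure M (Y \<inter> A i) \<le> p"
    and p: "0 < p" and \<eta>: "0 < \<eta>" "2 * \<eta> \<le> measure M Y"
  shows "\<eta> * ln (\<eta> / p) \<le> part_entropy M I A"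
proof -
  interpret prob_space M by fact
  have ent_nn: "0 \<le> ent_fun (measure M (A i))" for i
  proof (cases "measure M (A i) = 0")
    case False
    then have "measure M (A i) > 0" using measure_nonneg[of M "A i"] by linarith
    then have "ln (measure M (A i)) \<le> 0" by simp
    then show ?thesis by (simp add: ent_fun_def mult_nonneg_nonpos)
  qed (simp add: ent_fun_def)
  then have ent_ge_0: "0 \<le> part_entropy M I A" by (simp add: part_entropy_def sum_nonneg)
  show ?thesis
  proof (cases "p \<le> \<eta>")
    case False
    then have "ln (\<eta> / p) \<le> 0" using p \<eta>(1) by simp
    then have "\<eta> * ln (\<eta> / p) \<le> 0" using \<eta>(1) by (simp add: mult_nonneg_nonpos)
    then show ?thesis using ent_ge_0 by linarith
  next
    case True
    define Big where "Big = {i \<in> I. measure M (A i) > p / \<eta>}"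
    have finBig: "finite Big" "Big \<subseteq> I" using I by (auto simp: Big_def)
    have \<eta>0: "\<eta> > 0" using \<eta> by simp
    have "real (card Big) * (p / \<eta>) = (\<Sum>i\<in>Big. p / \<eta>)" by simp
    also have "\<dots> \<le> (\<Sum>i\<in>Big. measure M (A i))" by (rule sum_mono) (simp add: Big_def)
    also have "\<dots> = measure M (\<Union>i\<in>Big. A i)"
    proof -
      have "AE x in M. x \<notin> A i \<or> x \<notin> A j" if "i \<in> Big" "j \<in> Big" "i \<noteq> j" for i j
      proof -
        have "A i \<inter> A j \<in> null_sets M"
          using disj that finBig by (auto simp: ae_disjoint_family_on_def)
        from AE_not_in[OF this] show ?thesis by (rule eventually_mono) auto
      qed
      then have "pairwise (\<lambda>i j. AE x in M. x \<notin> A i \<or> x \<notin> A j) Big"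
        by (auto simp: pairwise_def)
      moreover have "A i \<in> fmeasurable M" if "i \<in> Big" for i
        using A that finBig by (auto simp: fmeasurable_eq_sets)
      ultimately show ?thesis using finBig(1) by (intro measure_UNION_AE[symmetric])
    qed
    also have "\<dots> \<le> 1" by simp
    finally have cB: "real (card Big) * p \<le> \<eta>" using \<eta>0 by (simp add: field_simps)
    have meas: "measure M Y \<le> (\<Sum>i\<in>I. measure M (Y \<inter> A i))"
    proof -
      have "measure M Y \<le> measure M (\<Union>i\<in>I. Y \<inter> A i)"
        using cover A Y I by (intro finite_measure_mono) auto
      also have "\<dots> \<le> (\<Sum>i\<in>I. measure M (Y \<inter> A i))"
        using A Y I by (intro finite_measure_subadditive_finite) auto
      finally show ?thesis .
    qed
    have "(\<Sum>i\<in>Big. measure M (Y \<inter> A i)) \<le> (\<Sum>i\<in>Big. p)"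
      using sub finBig by (intro sum_mono) auto
    then have "(\<Sum>i\<in>Big. measure M (Y \<inter> A i)) \<le> \<eta>" using cB by simp
    then have small: "\<eta> \<le> (\<Sum>i\<in>I - Big. measure M (Y \<inter> A i))"
      using meas \<eta>(2) sum.subset_diff[OF finBig(2) I, of "\<lambda>i. measure M (Y \<inter> A i)"] by linarith
    have lnn: "0 \<le> ln (\<eta> / p)" using p True by simp
    have "\<eta> * ln (\<eta> / p) \<le> (\<Sum>i\<in>I - Big. measure M (Y \<inter> A i)) * ln (\<eta> / p)"
      by (rule mult_right_mono[OF small lnn])
    also have "\<dots> = (\<Sum>i\<in>I - Big. measure M (Y \<inter> A i) * ln (\<eta> / p))" by (rule sum_distrib_right)
    also have "\<dots> \<le> (\<Sum>i\<in>I - Big. ent_fun (measure M (A i)))"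
    proof (rule sum_mono)
      fix i assume i: "i \<in> I - Big"
      have le: "measure M (Y \<inter> A i) \<le> measure M (A i)" using i A by (intro finite_measure_mono) auto
      show "measure M (Y \<inter> A i) * ln (\<eta> / p) \<le> ent_fun (measure M (A i))"
      proof (cases "measure M (A i) = 0")
        case True
        then show ?thesis using le measure_nonneg[of M "Y \<inter> A i"] by (simp add: ent_fun_def)
      next
        case False
        then have pos: "measure M (A i) > 0" using measure_nonneg[of M "A i"] by linarith
        have "measure M (A i) \<le> p / \<eta>" using i by (auto simp: Big_def)
        then have "ln (measure M (A i)) \<le> ln (p / \<eta>)" using pos p \<eta>0 by simp
        then have "ln (\<eta> / p) \<le> - ln (measure M (A i))" using p \<eta>0 by (simp add: ln_div)
        then have "measure M (Y \<inter> A i) * ln (\<eta> / p) \<le> measure M (A i) * - ln (measure M (A i))"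
          using le lnn by (intro mult_mono) auto
        then show ?thesis using False by (simp add: ent_fun_def)
      qed
    qed
    also have "\<dots> \<le> part_entropy M I A"
      unfolding part_entropy_def using I ent_nn by (intro sum_mono2) auto
    finally show ?thesis .
  qed
qed

section \<open>Cutting and stacking on the real line\<close>

text \<open>Column \<open>n + 1\<close> has height \<open>h (n + 1)\<close> and contains \<open>q n\<close> copies of column \<open>n\<close>, the \<open>l\<close>-th
  (counted from 0) starting at height \<open>st n l\<close>.\<close>

locale cut_and_stack =
  fixes h q :: "nat \<Rightarrow> nat" and st :: "nat \<Rightarrow> nat \<Rightarrow> nat"
  assumes h_0: "h 0 = 1"
    and q_ge: "q n \<ge> 2"
    and st_0: "st n 0 = 0"
    and st_step: "Suc l < q n \<Longrightarrow> st n l + h n \<le> st n (Suc l)"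
    and st_last: "st n (q n - 1) + h n = h (Suc n)"
    and growth: "2 ^ (n + 2) * h (Suc n) \<le> (2 ^ (n + 2) + 1) * (q n * h n)"
begin

primrec width :: "nat \<Rightarrow> real" where
  "width 0 = 1"
| "width (Suc n) = width n / real (q n)"

text \<open>The strip reserved for stage \<open>n + 1\<close> has room for all
  \<open>h (Suc n)\<close> levels, so a spacer at height \<open>i\<close> takes slot
  \<open>i\<close> without any counting of spacers. The slots of copies stay empty, which is
  harmless because only \<open>whole\<close> will carry measure.\<close>

primrec bound :: "nat \<Rightarrow> real" where
  "bound 0 = 1"
| "bound (Suc n) = bound n + real (h (Suc n)) * width (Suc n)"

definition is_copy :: "nat \<Rightarrow> nat \<Rightarrow> nat \<Rightarrow> nat \<Rightarrow> bool" where
  "is_copy n i l p \<longleftrightarrow> l < q n \<and> p < h n \<and> i = st n l + p"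

text \<open>Level \<open>i\<close> of column \<open>n\<close> is the interval \<open>[left n i, left n i + width n)\<close>. The spacers of column
  \<open>n + 1\<close> are put to the right of \<open>bound n\<close>, beyond everything used before.\<close>

primrec left :: "nat \<Rightarrow> nat \<Rightarrow> real" where
  "left 0 i = 0"
| "left (Suc n) i = (if \<exists>l p. is_copy n i l p
     then (let (l, p) = (SOME (l, p). is_copy n i l p) in left n p + real l * width (Suc n))
     else bound n + real i * width (Suc n))"

definition level :: "nat \<Rightarrow> nat \<Rightarrow> real set" where
  "level n i = {left n i..<left n i + width n}"

definition column :: "nat \<Rightarrow> real set" where
  "column n = (\<Union>i<h n. level n i)"

definition whole :: "real set" where
  "whole = (\<Union>n. column n)"

section \<open>Levels as intervals: disjointness and refinement\<close>

lemma st_mono_step: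
  assumes "l < l'" "l' < q n"
  shows "st n l + h n \<le> st n l'"
  using assms
proof (induction l')
  case (Suc l')
  then show ?case using st_step[of l' n] by (cases "l = l'") auto
qed simp

lemma is_copy_unique:
  assumes "is_copy n i l p" "is_copy n i l' p'"
  shows "l = l' \<and> p = p'"
proof -
  have "\<not> l < l'" "\<not> l' < l"
    using assms st_mono_step[of l l' n] st_mono_step[of l' l n] by (auto simp: is_copy_def)
  then show ?thesis using assms by (auto simp: is_copy_def)
qed

lemma left_copy:
  assumes "l < q n" "p < h n"
  shows "left (Suc n) (st n l + p) = left n p + real l * width (Suc n)"
proof -
  have c: "is_copy n (st n l + p) l p" using assms by (simp add: is_copy_def)
  have "(SOME (l', p'). is_copy n (st n l + p) l' p') = (l, p)"
  proof (rule some_equality)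
    show "case (l, p) of (l', p') \<Rightarrow> is_copy n (st n l + p) l' p'" using c by simp
    show "\<And>x. case x of (l', p') \<Rightarrow> is_copy n (st n l + p) l' p' \<Longrightarrow> x = (l, p)"
      using is_copy_unique[OF c] by auto
  qed
  then show ?thesis using c by (auto simp del: width.simps)
qed

lemma left_spacer:
  assumes "\<nexists>l p. is_copy n i l p"
  shows "left (Suc n) i = bound n + real i * width (Suc n)"
  using assms by (simp del: width.simps)

lemma h_pos: "h n > 0"
proof (induction n)
  case (Suc n)
  then show ?case using st_last[of n] by linarith
qed (simp add: h_0)

lemma q_pos: "q n > 0"
  using q_ge[of n] by simp

lemma width_pos: "width n > 0"
  by (induction n) (auto simp: q_pos)

lemma width_eq: "width n = real (q n) * width (Suc n)"
  using q_pos[of n] by simp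

lemma width_le: "width n \<le> (1 / 2) ^ n"
proof (induction n)
  case (Suc n)
  have "2 * width (Suc n) \<le> real (q n) * width (Suc n)"
    using q_ge[of n] width_pos[of "Suc n"] by (intro mult_right_mono) auto
  also have "\<dots> = width n" by (rule width_eq[symmetric])
  finally show ?case using Suc by (simp del: width.simps)
qed simp

lemma eventually_width_less:
  assumes "e > 0"
  shows "\<exists>m\<ge>n. width m < e"
proof -
  obtain k where k: "(1 / 2 :: real) ^ k < e" using real_arch_pow_inv[OF assms, of "1 / 2"] by auto
  have "width (max k n) \<le> (1 / 2) ^ max k n" by (rule width_le)
  also have "\<dots> \<le> (1 / 2) ^ k" by (rule power_decreasing) auto
  finally show ?thesis using k by (intro exI[of _ "max k n"]) auto
qed

lemma bound_mono: "bound n \<le> bound (Suc n)"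
  using width_pos[of "Suc n"] by (simp del: width.simps)

lemma width_copy_le:
  assumes "l < q n"
  shows "real l * width (Suc n) + width (Suc n) \<le> width n"
proof -
  have "real (Suc l) * width (Suc n) \<le> real (q n) * width (Suc n)"
    using assms width_pos[of "Suc n"] by (intro mult_right_mono) auto
  then show ?thesis using width_eq[of n] by (simp add: algebra_simps del: width.simps)
qed

lemma bound_nonneg: "0 \<le> bound n"
proof (induction n)
  case (Suc n)
  then show ?case using bound_mono[of n] by linarith
qed simp

lemma left_bounds:
  assumes "i < h n"
  shows "0 \<le> left n i \<and> left n i + width n \<le> bound n"
  using assms
proof (induction n arbitrary: i)
  case 0
  then show ?case by simp
next
  case (Suc n)
  have w: "width (Suc n) > 0" by (rule width_pos)
  show ?case
  proof (cases "\<exists>l p. is_copy n i l p")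
    case True
    then obtain l p where c: "l < q n" "p < h n" "i = st n l + p" by (auto simp: is_copy_def)
    have "left (Suc n) i = left n p + real l * width (Suc n)" using left_copy[OF c(1,2)] c(3) by simp
    moreover have "0 \<le> real l * width (Suc n)" using w by (intro mult_nonneg_nonneg) auto
    ultimately show ?thesis
      using Suc.IH[OF c(2)] width_copy_le[OF c(1)] bound_mono[of n] by linarith
  next
    case False
    have "real (Suc i) * width (Suc n) \<le> real (h (Suc n)) * width (Suc n)"
      using Suc.prems w by (intro mult_right_mono) auto
    then have "real i * width (Suc n) + width (Suc n) \<le> real (h (Suc n)) * width (Suc n)"
      by (simp add: algebra_simps del: width.simps)
    moreover have "0 \<le> real i * width (Suc n)" using w by (intro mult_nonneg_nonneg) auto
    moreover have "bound (Suc n) = bound n + real (h (Suc n)) * width (Suc n)" by (rule bound.simps)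
    ultimately show ?thesis using left_spacer[OF False] bound_nonneg[of n] by linarith
  qed
qed

lemma level_copy_subset:
  assumes "l < q n" "p < h n"
  shows "level (Suc n) (st n l + p) \<subseteq> level n p"
proof
  fix x assume "x \<in> level (Suc n) (st n l + p)"
  then have x: "left n p + real l * width (Suc n) \<le> x"
    "x < left n p + real l * width (Suc n) + width (Suc n)"
    using left_copy[OF assms] by (auto simp: level_def simp del: width.simps left.simps)
  have "0 \<le> real l * width (Suc n)" using width_pos[of "Suc n"] by (intro mult_nonneg_nonneg) auto
  then have "left n p \<le> x" "x < left n p + width n" using x width_copy_le[OF assms(1)] by linarith+
  then show "x \<in> level n p" by (simp add: level_def)
qed

lemma in_level_copy:
  assumes "x \<in> level n p" "p < h n"
  shows "\<exists>l<q n. x \<in> level (Suc n) (st n l + p)"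
proof -
  define w where "w = width (Suc n)"
  have w: "w > 0" by (simp add: w_def width_pos del: width.simps)
  define y where "y = (x - left n p) / w"
  have y: "0 \<le> y" "y < real (q n)"
    using assms(1) w width_eq[of n] by (auto simp: y_def level_def w_def field_simps simp del: width.simps)
  define l where "l = nat \<lfloor>y\<rfloor>"
  have l: "real l \<le> y" "y < real l + 1" using y(1) by (auto simp: l_def)
  have "l < q n" using l(1) y(2) by linarith
  moreover have "real l * w \<le> x - left n p" "x - left n p < (real l + 1) * w"
    using l w by (auto simp: y_def field_simps)
  ultimately show ?thesis
    using left_copy[of l n p] assms(2)
    by (intro exI[of _ l]) (auto simp: level_def w_def algebra_simps simp del: width.simps left.simps)
qed

lemma level_spacer_ge:
  assumes "\<nexists>l p. is_copy n i l p" "x \<in> level (Suc n) i"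
  shows "bound n \<le> x"
proof -
  have "0 \<le> real i * width (Suc n)" using width_pos[of "Suc n"] by (intro mult_nonneg_nonneg) auto
  moreover have "bound n + real i * width (Suc n) \<le> x"
    using assms(2) left_spacer[OF assms(1)] by (auto simp: level_def simp del: width.simps left.simps)
  ultimately show ?thesis by linarith
qed

lemma level_bounds:
  assumes "i < h n" "x \<in> level n i"
  shows "0 \<le> x" "x < bound n"
  using left_bounds[OF assms(1)] assms(2) by (auto simp: level_def)

lemma index_unique:
  fixes a w x :: real and k l :: nat
  assumes "w > 0" "a + real k * w \<le> x" "x < a + real k * w + w"
    "a + real l * w \<le> x" "x < a + real l * w + w"
  shows "k = l"
proof -
  have "real k * w < real (Suc l) * w" "real l * w < real (Suc k) * w"
    using assms by (auto simp: algebra_simps)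
  then show ?thesis using assms(1) by (simp add: mult_less_cancel_right_pos)
qed

text \<open>Two copies are told apart inside the levels of column \<open>n\<close> by induction, two
  spacers by their slots, and a copy and a spacer by \<open>bound n\<close>.\<close>

lemma level_disjoint:
  assumes "i < h n" "j < h n" "x \<in> level n i" "x \<in> level n j"
  shows "i = j"
  using assms
proof (induction n arbitrary: i j)
  case 0
  then show ?case using h_0 by simp
next
  case (Suc n)
  have w: "width (Suc n) > 0" by (rule width_pos)
  have mixed: False if "is_copy n i l p" "\<nexists>l p. is_copy n j l p"
    "x \<in> level (Suc n) i" "x \<in> level (Suc n) j" for i j l p
  proof -
    have "x \<in> level n p" "p < h n"
      using that(1,3) level_copy_subset[of l n p] by (auto simp: is_copy_def)
    then show False using level_bounds[of p n x] level_spacer_ge[OF that(2,4)] by linarith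
  qed
  show ?case
  proof (cases "\<exists>l p. is_copy n i l p")
    case i: True
    show ?thesis
    proof (cases "\<exists>l p. is_copy n j l p")
      case True
      from i True obtain l p l' p' where ij: "is_copy n i l p" "is_copy n j l' p'" by auto
      then have "x \<in> level n p" "x \<in> level n p'" "p < h n" "p' < h n"
        using Suc.prems level_copy_subset[of l n p] level_copy_subset[of l' n p']
        by (auto simp: is_copy_def)
      then have p: "p = p'" using Suc.IH by blast
      have "l = l'"
        using index_unique[OF w, of "left n p" l x l'] Suc.prems ij p
          left_copy[of l n p] left_copy[of l' n p]
        by (auto simp: level_def is_copy_def simp del: width.simps left.simps)
      then show ?thesis using ij p by (simp add: is_copy_def)
    next
      case False
      then show ?thesis using i mixed Suc.prems by blast
    qed
  next
    case i: False
    show ?thesis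
    proof (cases "\<exists>l p. is_copy n j l p")
      case True
      then show ?thesis using i mixed Suc.prems by blast
    next
      case False
      then show ?thesis
        using index_unique[OF w, of "bound n" i x j] Suc.prems left_spacer[OF i] left_spacer[OF False]
        by (auto simp: level_def simp del: width.simps left.simps)
    qed
  qed
qed

lemma copy_less:
  assumes "l < q n" "p < h n"
  shows "st n l + p < h (Suc n)"
proof -
  have "st n l + h n \<le> st n (q n - 1) + h n"
  proof (cases "l = q n - 1")
    case False
    then have "l < q n - 1" "q n - 1 < q n" using assms(1) by auto
    then show ?thesis using st_mono_step[of l "q n - 1" n] by linarith
  qed simp
  then show ?thesis using st_last[of n] assms by linarith
qed

lemma column_mono: "n \<le> m \<Longrightarrow> column n \<subseteq> column m"
proof (induction m rule: dec_induct)
  case (step m)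
  have "column m \<subseteq> column (Suc m)"
    using in_level_copy copy_less by (fastforce simp: column_def)
  then show ?case using step by blast
qed simp

lemma spacer_disjoint_column:
  assumes "\<nexists>l p. is_copy n i l p" "x \<in> level (Suc n) i"
  shows "x \<notin> column n"
  using level_spacer_ge[OF assms] level_bounds by (fastforce simp: column_def)

lemma left_base: "left n 0 = 0"
proof (induction n)
  case (Suc n)
  then show ?case using left_copy[of 0 n 0] q_pos h_pos st_0 by simp
qed simp

text \<open>Going back from column \<open>m\<close>, a level either stays inside copies down to
  column \<open>n\<close> or is a spacer at some stage and then lies beyond everything older. This
  makes the tower partitions refining and gives each level of column \<open>m\<close> a single cell
  of the partition of column \<open>n\<close>.\<close>

lemma level_refine:
  assumes "n \<le> m" "i < h m"
  shows "level m i \<inter> column n = {} \<or> (\<exists>p<h n. level m i \<subseteq> level n p)"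
  using assms
proof (induction m arbitrary: i rule: dec_induct)
  case base
  then show ?case by auto
next
  case (step m)
  show ?case
  proof (cases "\<exists>l p. is_copy m i l p")
    case True
    then obtain l p where c: "l < q m" "p < h m" "i = st m l + p" by (auto simp: is_copy_def)
    then show ?thesis using step.IH[OF c(2)] level_copy_subset[OF c(1,2)] by blast
  next
    case False
    then show ?thesis using spacer_disjoint_column[OF False] column_mono[OF \<open>n \<le> m\<close>] by blast
  qed
qed

section \<open>The stacking map and its bijectivity\<close>

definition shift :: "nat \<Rightarrow> nat \<Rightarrow> real" where
  "shift n i = left n (Suc i) - left n i"

definition below_top :: "nat \<Rightarrow> nat \<Rightarrow> real \<Rightarrow> bool" where
  "below_top n i x \<longleftrightarrow> Suc i < h n \<and> x \<in> level n i"

definition neg_ints :: "real set" where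
  "neg_ints = range (\<lambda>k::nat. - real (Suc k))"

text \<open>The stacking map sends \<open>whole\<close> onto \<open>whole - {0}\<close>. It becomes a bijection of the line by moving
  the (null) set of negative integers one step to the right.\<close>

definition T :: "real \<Rightarrow> real" where
  "T x = (if \<exists>n i. below_top n i x then x + (SOME d. \<exists>n i. below_top n i x \<and> d = shift n i)
     else if x \<in> neg_ints then x + 1 else x)"

text \<open>Consecutive levels are cut at equal offsets, and a copy keeps the pieces consecutive.
  Hence column \<open>n + 1\<close> prescribes the same translation as column \<open>n\<close>,
  which makes the map well defined.\<close>

lemma below_top_Suc:
  assumes "below_top n i x"
  shows "\<exists>j. below_top (Suc n) j x \<and> shift (Suc n) j = shift n i"
proof -
  obtain l where l: "l < q n" "x \<in> level (Suc n) (st n l + i)"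
    using in_level_copy[of x n i] assms by (auto simp: below_top_def)
  have i: "Suc i < h n" using assms by (simp add: below_top_def)
  have "Suc (st n l + i) < h (Suc n)" using copy_less[OF l(1) i] by simp
  moreover have "shift (Suc n) (st n l + i) = shift n i"
    using left_copy[OF l(1), of i] left_copy[OF l(1) i] i
    by (simp add: shift_def del: width.simps left.simps)
  ultimately show ?thesis using l(2) by (intro exI[of _ "st n l + i"]) (simp add: below_top_def)
qed

lemma below_top_mono:
  assumes "n \<le> m" "below_top n i x"
  shows "\<exists>j. below_top m j x \<and> shift m j = shift n i"
  using assms
proof (induction m rule: dec_induct)
  case (step m)
  then show ?case using below_top_Suc by metis
qed blast

lemma below_top_shift_unique:
  assumes "below_top n i x" "below_top m j x"
  shows "shift n i = shift m j"
proof -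
  obtain i' where i': "below_top (max n m) i' x" "shift (max n m) i' = shift n i"
    using below_top_mono[OF max.cobounded1 assms(1)] by blast
  obtain j' where j': "below_top (max n m) j' x" "shift (max n m) j' = shift m j"
    using below_top_mono[OF max.cobounded2 assms(2)] by blast
  have "i' = j'"
    using i' j' level_disjoint[of i' "max n m" j' x] by (simp add: below_top_def)
  then show ?thesis using i' j' by simp
qed

lemma T_below_top:
  assumes "below_top n i x"
  shows "T x = x + shift n i"
proof -
  have "(SOME d. \<exists>n i. below_top n i x \<and> d = shift n i) = shift n i"
    using assms below_top_shift_unique by (intro some_equality) blast+
  then show ?thesis using assms by (auto simp: T_def)
qed

lemma shift_level: "x \<in> level n i \<longleftrightarrow> x + shift n i \<in> level n (Suc i)"
  by (auto simp: level_def shift_def)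

lemma T_in_level:
  assumes "below_top n i x"
  shows "T x \<in> level n (Suc i)"
  using assms shift_level T_below_top[OF assms] by (auto simp: below_top_def)

lemma T_image_level:
  assumes "Suc i < h n"
  shows "T ` level n i = level n (Suc i)"
proof (intro equalityI subsetI)
  fix y assume "y \<in> T ` level n i"
  then show "y \<in> level n (Suc i)" using assms T_in_level by (auto simp: below_top_def)
next
  fix y assume y: "y \<in> level n (Suc i)"
  then have x: "below_top n i (y - shift n i)"
    using assms shift_level[of "y - shift n i" n i] by (simp add: below_top_def)
  then have "T (y - shift n i) = y" using T_below_top by simp
  then show "y \<in> T ` level n i" using x by (metis below_top_def image_eqI)
qed

lemma funpow_image_Suc: "(f ^^ Suc k) ` A = f ` (f ^^ k) ` A"
  by (simp add: image_comp)

lemma T_funpow_level: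
  assumes "i + k < h n"
  shows "(T ^^ k) ` level n i = level n (i + k)"
  using assms
proof (induction k)
  case (Suc k)
  then show ?case using T_image_level[of "i + k" n] by (simp only: funpow_image_Suc) simp
qed simp

lemma in_whole_iff: "x \<in> whole \<longleftrightarrow> (\<exists>n. \<exists>i<h n. x \<in> level n i)"
  by (auto simp: whole_def column_def)

text \<open>The danger is a point in the top level of every later column. The top level of column
  \<open>m + 1\<close> is the rightmost piece of that of column \<open>m\<close>, so these levels
  share the right endpoint \<open>b\<close> while their widths tend to 0. The intervals are half
  open, so \<open>b\<close> is excluded and no point remains.\<close>

lemma whole_below_top: "x \<in> whole \<longleftrightarrow> (\<exists>n i. below_top n i x)"
proof
  assume "x \<in> whole"
  then obtain n i where n: "i < h n" "x \<in> level n i" by (auto simp: in_whole_iff)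
  show "\<exists>n i. below_top n i x"
  proof (rule ccontr)
    assume no: "\<nexists>n i. below_top n i x"
    define b where "b = left n (h n - 1) + width n"
    have top: "x \<in> level m (h m - 1) \<and> left m (h m - 1) + width m = b" if "n \<le> m" for m
      using that
    proof (induction m rule: dec_induct)
      case base
      have "i = h n - 1" using no n by (cases "Suc i < h n") (auto simp: below_top_def)
      then show ?case using n by (simp add: b_def)
    next
      case (step m)
      have hm: "h m - 1 < h m" using h_pos[of m] by simp
      have qm: "q m - 1 < q m" using q_pos[of m] by simp
      have e: "h (Suc m) - 1 = st m (q m - 1) + (h m - 1)" using st_last[of m] h_pos[of m] by linarith
      obtain l where l: "l < q m" "x \<in> level (Suc m) (st m l + (h m - 1))"
        using in_level_copy[OF _ hm] step.IH by blast
      have "\<not> Suc (st m l + (h m - 1)) < h (Suc m)" using no l(2) by (auto simp: below_top_def)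
      then have "st m l + (h m - 1) = h (Suc m) - 1" using copy_less[OF l(1) hm] by linarith
      then have 1: "x \<in> level (Suc m) (h (Suc m) - 1)" using l(2) by simp
      have "real (q m - 1) = real (q m) - 1" using q_pos[of m] by (simp add: of_nat_diff)
      then have "real (q m - 1) * width (Suc m) + width (Suc m) = width m"
        using width_eq[of m] by (simp add: algebra_simps del: width.simps)
      then have "left (Suc m) (h (Suc m) - 1) + width (Suc m) = b"
        using left_copy[OF qm hm] e step.IH by (simp del: width.simps left.simps)
      then show ?case using 1 by simp
    qed
    have "x < b" using top[of n] by (auto simp: level_def)
    then obtain m where "m \<ge> n" "width m < b - x" using eventually_width_less[of "b - x" n] by auto
    then show False using top[of m] by (auto simp: level_def)
  qed
next
  assume "\<exists>n i. below_top n i x"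
  then show "x \<in> whole" unfolding in_whole_iff below_top_def using Suc_lessD by blast
qed

lemma zero_in_level: "0 \<in> level n 0"
  using width_pos[of n] by (simp add: level_def left_base)

text \<open>The base levels \<open>[0, width n)\<close> shrink to 0, and this left endpoint, unlike
  a right one, belongs to them. So 0 is the one point of \<open>whole\<close> with no preimage in
  \<open>whole\<close>, which the shift of the negative integers repairs.\<close>

lemma whole_above_base: "x \<in> whole - {0} \<longleftrightarrow> (\<exists>n i. Suc i < h n \<and> x \<in> level n (Suc i))"
proof
  assume x: "x \<in> whole - {0}"
  then obtain n i where n: "i < h n" "x \<in> level n i" by (auto simp: in_whole_iff)
  show "\<exists>n i. Suc i < h n \<and> x \<in> level n (Suc i)"
  proof (rule ccontr)
    assume no: "\<nexists>n i. Suc i < h n \<and> x \<in> level n (Suc i)"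
    have base: "x \<in> level m 0" if "n \<le> m" for m
      using that
    proof (induction m rule: dec_induct)
      case base
      show ?case using no n by (cases i) auto
    next
      case (step m)
      then obtain l where l: "l < q m" "x \<in> level (Suc m) (st m l)"
        using in_level_copy[of x m 0] h_pos by auto
      have "st m l < h (Suc m)" using copy_less[OF l(1) h_pos] by simp
      then show ?case using no l(2) by (cases "st m l") auto
    qed
    have "x > 0" using level_bounds(1)[OF n] x by simp
    then obtain m where "m \<ge> n" "width m < x" using eventually_width_less by blast
    then show False using base[of m] by (auto simp: level_def left_base)
  qed
next
  assume "\<exists>n i. Suc i < h n \<and> x \<in> level n (Suc i)"
  then obtain n i where "Suc i < h n" "x \<in> level n (Suc i)" by blast
  then show "x \<in> whole - {0}"
    using level_disjoint[of "Suc i" n 0 x] zero_in_level[of n] by (auto simp: in_whole_iff h_pos)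
qed

lemma whole_nonneg: "x \<in> whole \<Longrightarrow> 0 \<le> x"
  using level_bounds(1) by (auto simp: in_whole_iff)

lemma neg_ints_neg: "x \<in> neg_ints \<Longrightarrow> x < 0"
  by (auto simp: neg_ints_def)

lemma T_neg_int: "x \<in> neg_ints \<Longrightarrow> T x = x + 1"
  using whole_below_top[of x] whole_nonneg[of x] neg_ints_neg[of x] by (auto simp: T_def)

lemma T_elsewhere: "x \<notin> whole \<Longrightarrow> x \<notin> neg_ints \<Longrightarrow> T x = x"
  using whole_below_top[of x] by (auto simp: T_def)

lemma T_whole: "x \<in> whole \<Longrightarrow> T x \<in> whole - {0}"
proof -
  assume "x \<in> whole"
  then obtain n i where b: "below_top n i x" using whole_below_top by blast
  then have "Suc i < h n" by (simp add: below_top_def)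
  then show "T x \<in> whole - {0}" unfolding whole_above_base using T_in_level[OF b] by blast
qed

lemma neg_ints_succ: "x \<in> neg_ints \<Longrightarrow> x + 1 = 0 \<or> x + 1 \<in> neg_ints"
proof -
  assume "x \<in> neg_ints"
  then obtain k where "x = - real (Suc k)" by (auto simp: neg_ints_def)
  then show ?thesis by (cases k) (auto simp: neg_ints_def)
qed

lemma zero_in_whole: "0 \<in> whole"
  using zero_in_level h_pos by (auto simp: in_whole_iff)

lemma T_inj_whole:
  assumes "x \<in> whole" "y \<in> whole" "T x = T y"
  shows "x = y"
proof -
  obtain n i m j where "below_top n i x" "below_top m j y"
    using assms whole_below_top by blast
  then obtain i j where ij: "below_top (max n m) i x" "below_top (max n m) j y"
    using below_top_mono[OF max.cobounded1, of n i x m] below_top_mono[OF max.cobounded2, of m j y n]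
    by blast
  then have "Suc i = Suc j"
    using T_in_level[OF ij(1)] T_in_level[OF ij(2)] assms(3)
      level_disjoint[of "Suc i" "max n m" "Suc j" "T x"]
    by (simp add: below_top_def)
  then have "x + shift (max n m) i = y + shift (max n m) i"
    using T_below_top[OF ij(1)] T_below_top[OF ij(2)] assms(3) by (metis Suc_inject)
  then show ?thesis by (rule add_right_imp_eq)
qed

lemma inj_T: "inj T"
proof (rule injI)
  fix x y assume eq: "T x = T y"
  \<comment> \<open>The three kinds of points have their images in \<open>whole - {0}\<close>, in 0
    together with the negative integers, and in the rest of the line, so equal images force equal
    kinds.\<close>
  have kind: "(x \<in> whole \<and> T x \<in> whole - {0}) \<or>
      (x \<in> neg_ints \<and> T x = x + 1 \<and> (T x = 0 \<or> T x \<in> neg_ints)) \<or>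
      (x \<notin> whole \<and> x \<notin> neg_ints \<and> T x = x)" for x
  proof (cases "x \<in> neg_ints")
    case True
    then have "T x = x + 1" "T x = 0 \<or> T x \<in> neg_ints"
      using T_neg_int[of x] neg_ints_succ[of x] by auto
    then show ?thesis using True by blast
  next
    case False
    then show ?thesis using T_whole[of x] T_elsewhere[of x] by blast
  qed
  have disj: "z \<notin> whole" if "z \<in> neg_ints" for z
    using neg_ints_neg[OF that] whole_nonneg[of z] by auto
  define v where "v = T x"
  have v: "T x = v" "T y = v" using eq by (simp_all add: v_def)
  have "x = y" if "\<not> (x \<in> whole \<and> y \<in> whole)"
    using that kind[of x] kind[of y] disj[of x] disj[of y] disj[of v] zero_in_whole
    unfolding v by auto
  then show "x = y" using T_inj_whole eq by blast
qed

lemma T_image_whole: "T ` whole = whole - {0}"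
proof (intro equalityI subsetI)
  fix y assume "y \<in> whole - {0}"
  then obtain n i where n: "Suc i < h n" "y \<in> level n (Suc i)" using whole_above_base by blast
  then obtain x where x: "x \<in> level n i" "y = T x" using T_image_level by blast
  have "i < h n" using n(1) by simp
  then have "x \<in> whole" unfolding in_whole_iff using x(1) by blast
  then show "y \<in> T ` whole" using x(2) by simp
qed (use T_whole in auto)

lemma surj_T: "surj T"
proof -
  have "y \<in> range T" for y
  proof (cases "y \<in> whole - {0}")
    case True
    then show ?thesis using T_image_whole by blast
  next
    case False
    show ?thesis
    proof (cases "y = 0 \<or> y \<in> neg_ints")
      case True
      then have "y - 1 \<in> neg_ints"
      proof
        assume "y = 0"
        then show ?thesis by (auto simp: neg_ints_def intro!: image_eqI[of _ _ 0])
      next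
        assume "y \<in> neg_ints"
        then obtain k where "y = - real (Suc k)" by (auto simp: neg_ints_def)
        then show ?thesis by (auto simp: neg_ints_def intro!: image_eqI[of _ _ "Suc k"])
      qed
      then have "T (y - 1) = y" using T_neg_int[of "y - 1"] by simp
      then show ?thesis by (metis rangeI)
    next
      case no: False
      then have "T y = y" using False by (intro T_elsewhere) auto
      then show ?thesis by (metis rangeI)
    qed
  qed
  then show ?thesis by auto
qed

lemma bij_T: "bij T"
  using inj_T surj_T by (simp add: bij_def)

section \<open>Measurability of the map and of its inverse\<close>

lemma level_borel [measurable]: "level n i \<in> sets borel"
  by (simp add: level_def)

lemma column_borel [measurable]: "column n \<in> sets borel"
  unfolding column_def by measurable

lemma whole_borel [measurable]: "whole \<in> sets borel"
  unfolding whole_def by measurable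

lemma countable_neg_ints: "countable neg_ints"
  by (simp add: neg_ints_def)

lemma neg_ints_borel [measurable]: "neg_ints \<in> sets borel"
  by (rule sets.countable[OF _ countable_neg_ints]) simp

text \<open>The map is a translation on each of countably many Borel pieces, so measurability can be
  read off. Pieces from different columns overlap, but there the translations agree.\<close>

lemma T_vimage:
  "T -` A = (\<Union>n. \<Union>i\<in>{i. Suc i < h n}. level n i \<inter> (\<lambda>x. x + shift n i) -` A)
     \<union> (neg_ints \<inter> (\<lambda>x. x + 1) -` A) \<union> (A - whole - neg_ints)"
proof -
  have "T x \<in> A \<longleftrightarrow> (\<exists>n i. Suc i < h n \<and> x \<in> level n i \<and> x + shift n i \<in> A)
      \<or> x \<in> neg_ints \<and> x + 1 \<in> A \<or> x \<in> A - whole - neg_ints" for x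
  proof (cases "x \<in> whole")
    case True
    then have "x \<notin> neg_ints" using whole_nonneg[of x] neg_ints_neg[of x] by auto
    moreover have "T x \<in> A \<longleftrightarrow> (\<exists>n i. below_top n i x \<and> x + shift n i \<in> A)"
    proof
      assume "T x \<in> A"
      moreover obtain n i where "below_top n i x" using True whole_below_top by blast
      ultimately show "\<exists>n i. below_top n i x \<and> x + shift n i \<in> A"
        using T_below_top[of n i x] by auto
    next
      assume "\<exists>n i. below_top n i x \<and> x + shift n i \<in> A"
      then obtain n i where "below_top n i x" "x + shift n i \<in> A" by blast
      then show "T x \<in> A" using T_below_top[of n i x] by simp
    qed
    ultimately show ?thesis using True unfolding below_top_def by blast
  next
    case False
    then have no: "\<not> (\<exists>n i. Suc i < h n \<and> x \<in> level n i \<and> x + shift n i \<in> A)"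
      using whole_below_top[of x] by (auto simp: below_top_def)
    show ?thesis
    proof (cases "x \<in> neg_ints")
      case True
      show ?thesis unfolding T_neg_int[OF True] using no True by blast
    next
      case neg: False
      show ?thesis unfolding T_elsewhere[OF False neg] using no False neg by blast
    qed
  qed
  note mem = this
  show ?thesis
  proof (rule set_eqI)
    fix x
    show "x \<in> T -` A \<longleftrightarrow> x \<in> (\<Union>n. \<Union>i\<in>{i. Suc i < h n}. level n i \<inter> (\<lambda>x. x + shift n i) -` A)
     \<union> (neg_ints \<inter> (\<lambda>x. x + 1) -` A) \<union> (A - whole - neg_ints)"
      unfolding vimage_eq mem[of x] by blast
  qed
qed

lemma T_measurable: "T \<in> borel_measurable borel"
proof (rule measurableI)
  fix A :: "real set" assume [measurable]: "A \<in> sets borel"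
  have [measurable]: "(\<lambda>x::real. x + c) -` A \<in> sets borel" for c
    using measurable_sets[of "\<lambda>x::real. x + c" borel borel A] by simp
  have "T -` A \<in> sets borel" unfolding T_vimage by measurable
  then show "T -` A \<inter> space borel \<in> sets borel" by simp
qed simp

text \<open>By bijectivity an image under \<open>T\<close> is a preimage under the inverse, so this
  serves as the preimage formula for the inverse.\<close>

lemma T_image:
  "T ` A = (\<Union>n. \<Union>i\<in>{i. Suc i < h n}. (\<lambda>x. x - shift n i) -` (level n i \<inter> A))
     \<union> (\<lambda>x. x - 1) -` (neg_ints \<inter> A) \<union> (A - whole - neg_ints)"
proof -
  have "T x \<in> (\<Union>n. \<Union>i\<in>{i. Suc i < h n}. (\<lambda>x. x - shift n i) -` (level n i \<inter> A))
     \<union> (\<lambda>x. x - 1) -` (neg_ints \<inter> A) \<union> (A - whole - neg_ints)" if "x \<in> A" for x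
  proof (cases "x \<in> whole")
    case True
    then obtain n i where "below_top n i x" using whole_below_top by blast
    then have "Suc i < h n" "T x - shift n i \<in> level n i \<inter> A"
      using T_below_top[of n i x] that by (auto simp: below_top_def)
    then show ?thesis by blast
  next
    case False
    then show ?thesis using that T_neg_int[of x] T_elsewhere[of x] by (cases "x \<in> neg_ints") auto
  qed
  moreover have "y \<in> T ` A" if "Suc i < h n" "y - shift n i \<in> level n i \<inter> A" for n i y
  proof -
    have "T (y - shift n i) = y" using that T_below_top[of n i "y - shift n i"] by (simp add: below_top_def)
    then show ?thesis using that(2) by (metis IntD2 imageI)
  qed
  moreover have "y \<in> T ` A" if "y - 1 \<in> neg_ints \<inter> A" for y
  proof -
    have "T (y - 1) = y" using that T_neg_int[of "y - 1"] by simp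
    then show ?thesis using that by (metis IntD2 imageI)
  qed
  moreover have "y \<in> T ` A" if "y \<in> A - whole - neg_ints" for y
    using that T_elsewhere[of y] by (metis Diff_iff imageI)
  ultimately show ?thesis by blast
qed

lemma T_inv_measurable: "the_inv_into UNIV T \<in> borel_measurable borel"
proof (rule measurableI)
  fix A :: "real set" assume [measurable]: "A \<in> sets borel"
  have meas: "(\<lambda>x::real. x - c) -` B \<in> sets borel" if "B \<in> sets borel" for c B
    using measurable_sets[of "\<lambda>x::real. x - c" borel borel B] that by simp
  have [measurable]: "(\<lambda>x::real. x - c) -` (level n i \<inter> A) \<in> sets borel"
    "(\<lambda>x::real. x - c) -` (neg_ints \<inter> A) \<in> sets borel" for c n i
    by (auto intro: meas)
  have "T ` A \<in> sets borel" unfolding T_image by measurable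
  moreover have "the_inv_into UNIV T -` A = T ` A"
  proof (rule set_eqI)
    fix y
    obtain x where y: "y = T x" using surj_T by (metis surjD)
    show "y \<in> the_inv_into UNIV T -` A \<longleftrightarrow> y \<in> T ` A"
      unfolding y by (simp add: the_inv_into_f_f inj_image_mem_iff inj_T)
  qed
  ultimately show "the_inv_into UNIV T -` A \<inter> space borel \<in> sets borel" by simp
qed simp

section \<open>Lebesgue measure of the columns\<close>

lemma emeasure_level: "emeasure lborel (level n i) = ennreal (width n)"
  using width_pos[of n] by (simp add: level_def)

lemma emeasure_column_Int:
  assumes [measurable]: "A \<in> sets borel" and I: "finite I" "I \<subseteq> {..<h n}"
  shows "emeasure lborel ((\<Union>i\<in>I. level n i) \<inter> A) = (\<Sum>i\<in>I. emeasure lborel (level n i \<inter> A))"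
proof -
  have "disjoint_family_on (\<lambda>i. level n i \<inter> A) I"
    unfolding disjoint_family_on_def
  proof (intro ballI impI)
    fix i j assume ij: "i \<in> I" "j \<in> I" "i \<noteq> j"
    then have "i < h n" "j < h n" using I by auto
    show "level n i \<inter> A \<inter> (level n j \<inter> A) = {}"
    proof (rule equals0I)
      fix x assume "x \<in> level n i \<inter> A \<inter> (level n j \<inter> A)"
      then show False using level_disjoint[of i n j x] ij(3) \<open>i < h n\<close> \<open>j < h n\<close> by simp
    qed
  qed
  then have "(\<Sum>i\<in>I. emeasure lborel (level n i \<inter> A)) = emeasure lborel (\<Union>i\<in>I. level n i \<inter> A)"
    using I by (intro sum_emeasure) auto
  then show ?thesis by (simp add: Int_UN_distrib2)
qed

lemma emeasure_levels:
  assumes "I \<subseteq> {..<h n}"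
  shows "emeasure lborel (\<Union>i\<in>I. level n i) = ennreal (real (card I) * width n)"
proof -
  have "finite I" using assms finite_subset by blast
  then have "emeasure lborel (\<Union>i\<in>I. level n i) = (\<Sum>i\<in>I. ennreal (width n))"
    using emeasure_column_Int[of UNIV I n] assms by (simp add: emeasure_level del: sum_constant)
  also have "\<dots> = ennreal (\<Sum>i\<in>I. width n)"
    using width_pos[of n] by (intro sum_ennreal) simp
  finally show ?thesis by simp
qed

definition mass :: "nat \<Rightarrow> real" where
  "mass n = real (h n) * width n"

lemma emeasure_column: "emeasure lborel (column n) = ennreal (mass n)"
  using emeasure_levels[of "{..<h n}" n] by (simp add: column_def mass_def)

lemma mass_nonneg: "0 \<le> mass n"
  using width_pos[of n] by (simp add: mass_def)

lemma mass_mono: "n \<le> m \<Longrightarrow> mass n \<le> mass m"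
  using emeasure_mono[OF column_mono, of n m lborel] mass_nonneg[of m]
  by (simp add: emeasure_column)

lemma mass_Suc_le: "mass (Suc n) \<le> (1 + (1 / 2) ^ (n + 2)) * mass n"
proof -
  have "2 ^ (n + 2) * real (h (Suc n)) = real (2 ^ (n + 2) * h (Suc n))" by simp
  also have "\<dots> \<le> real ((2 ^ (n + 2) + 1) * (q n * h n))" using growth[of n] by (simp only: of_nat_le_iff)
  also have "\<dots> = (2 ^ (n + 2) + 1) * (real (q n) * real (h n))" by (simp add: algebra_simps)
  finally have "2 ^ (n + 2) * real (h (Suc n)) * width (Suc n)
      \<le> (2 ^ (n + 2) + 1) * (real (q n) * real (h n)) * width (Suc n)"
    using width_pos[of "Suc n"] by (intro mult_right_mono) auto
  also have "\<dots> = (2 ^ (n + 2) + 1) * (real (h n) * (real (q n) * width (Suc n)))"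
    by (simp only: mult_ac)
  also have "real (q n) * width (Suc n) = width n" by (rule width_eq[symmetric])
  finally have "2 ^ (n + 2) * mass (Suc n) \<le> (2 ^ (n + 2) + 1) * mass n"
    by (simp only: mass_def mult_ac)
  then show ?thesis by (simp add: field_simps power_one_over)
qed

text \<open>The bound \<open>2 - (1 / 2) ^ n\<close> closes the induction: mass at most 2 makes the
  increment at most \<open>(1 / 2) ^ (n + 2) * 2\<close>, exactly the distance between consecutive
  bounds.\<close>

lemma mass_increment: "mass n \<le> 2 - (1 / 2) ^ n \<and> mass (Suc n) - mass n \<le> (1 / 2) ^ (n + 1)"
proof -
  have step: "mass (Suc n) - mass n \<le> (1 / 2) ^ (n + 1)" if "mass n \<le> 2" for n
  proof -
    have "mass (Suc n) - mass n \<le> (1 / 2) ^ (n + 2) * mass n"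
      using mass_Suc_le[of n] by (simp add: algebra_simps)
    also have "\<dots> \<le> (1 / 2) ^ (n + 2) * 2" using that by (intro mult_left_mono) auto
    finally show ?thesis by simp
  qed
  have "mass n \<le> 2 - (1 / 2) ^ n"
  proof (induction n)
    case (Suc n)
    have "(1 / 2 :: real) ^ n \<ge> 0" by simp
    then have "mass n \<le> 2" using Suc by linarith
    then have "mass (Suc n) \<le> mass n + (1 / 2) ^ n / 2" using step[of n] by simp
    then show ?case using Suc by simp
  qed (simp add: mass_def h_0)
  moreover have "(1 / 2 :: real) ^ n \<ge> 0" by simp
  moreover from calculation have "mass n \<le> 2" by linarith
  ultimately show ?thesis using step[of n] by blast
qed

lemma mass_le_2: "mass n \<le> 2"
proof -
  have "(1 / 2 :: real) ^ n \<ge> 0" by simp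
  then show ?thesis using mass_increment[of n] by linarith
qed

lemma mass_ge_1: "1 \<le> mass n"
  using mass_mono[of 0 n] by (simp add: mass_def h_0)

lemma mass_diff_le:
  assumes "n \<le> m"
  shows "mass m - mass n \<le> (1 / 2) ^ n"
proof -
  have "mass m - mass n \<le> (1 / 2) ^ n - (1 / 2) ^ m"
    using assms
  proof (induction m rule: dec_induct)
    case (step m)
    then show ?case using mass_increment[of m] by simp
  qed simp
  moreover have "(1 / 2 :: real) ^ m \<ge> 0" by simp
  ultimately show ?thesis by linarith
qed

lemma emeasure_whole: "1 \<le> emeasure lborel whole" "emeasure lborel whole \<le> 2"
proof -
  have "incseq column" using column_mono by (simp add: incseq_def)
  then have "(SUP n. emeasure lborel (column n)) = emeasure lborel whole"
    unfolding whole_def by (intro SUP_emeasure_incseq) auto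
  moreover have "(SUP n. emeasure lborel (column n)) \<le> ennreal 2"
    unfolding emeasure_column using mass_le_2 by (intro SUP_least ennreal_leI)
  moreover have "ennreal 1 \<le> emeasure lborel (column 0)"
    unfolding emeasure_column using mass_ge_1 by (rule ennreal_leI)
  moreover have "emeasure lborel (column 0) \<le> emeasure lborel whole"
    by (rule emeasure_mono) (auto simp: whole_def)
  ultimately show "1 \<le> emeasure lborel whole" "emeasure lborel whole \<le> 2" by auto
qed

text \<open>The space is the whole line although only \<open>whole\<close> has mass: the usual
  topology then witnesses a standard space, at the price that \<open>T\<close> must be a bijection
  of the line.\<close>

definition M :: "real measure" where
  "M = uniform_measure lborel whole"

lemma sets_M [simp]: "sets M = sets borel"
  by (simp add: M_def)

lemma space_M [simp]: "space M = UNIV"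
  by (simp add: M_def)

lemma emeasure_whole_fin: "emeasure lborel whole \<noteq> 0" "emeasure lborel whole \<noteq> \<infinity>"
proof -
  show "emeasure lborel whole \<noteq> 0" using emeasure_whole(1) by (intro notI) simp
  have "emeasure lborel whole < \<infinity>"
    using emeasure_whole(2) by (rule le_less_trans) (simp add: ennreal_numeral[symmetric] del: ennreal_numeral)
  then show "emeasure lborel whole \<noteq> \<infinity>" by simp
qed

lemma prob_space_M: "prob_space M"
  unfolding M_def using emeasure_whole_fin by (rule prob_space_uniform_measure)

lemma emeasure_M: "A \<in> sets borel \<Longrightarrow> emeasure M A = emeasure lborel (whole \<inter> A) / emeasure lborel whole"
  unfolding M_def by (rule emeasure_uniform_measure) auto

section \<open>Invariance of the normalised measure\<close>

lemma emeasure_lborel_translate: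
  assumes "A \<in> sets borel"
  shows "emeasure lborel ((\<lambda>x::real. x + c) -` A) = emeasure lborel A"
proof -
  have "emeasure lborel A = emeasure (distr lborel borel ((+) c)) A" by (simp add: lborel_distr_plus)
  also have "\<dots> = emeasure lborel ((\<lambda>x::real. x + c) -` A)"
    using assms by (subst emeasure_distr) (simp_all add: vimage_def add.commute)
  finally show ?thesis by simp
qed

text \<open>Exhaustion by the points below the top of column \<open>n\<close>. There
  \<open>T\<close> translates level by level, so the part sent into \<open>A\<close> and its image
  have equal measure; the limits are the two sides, up to the point 0 missed by the image.\<close>

lemma emeasure_whole_vimage:
  assumes A [measurable]: "A \<in> sets borel"
  shows "emeasure lborel (whole \<inter> T -` A) = emeasure lborel (whole \<inter> A)"
proof -
  have [measurable]: "T -` A \<in> sets borel" using measurable_sets[OF T_measurable A] by simp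
  define I where "I n = {i. Suc i < h n}" for n
  have I: "finite (I n)" "I n \<subseteq> {..<h n}" for n
    by (auto simp: I_def intro: finite_subset[of _ "{..<h n}"])
  define D where "D n = (\<Union>i\<in>I n. level n i) \<inter> T -` A" for n
  define U where "U n = (\<Union>i\<in>Suc ` I n. level n i) \<inter> A" for n
  have mem_D: "x \<in> D n \<longleftrightarrow> (\<exists>i. below_top n i x) \<and> T x \<in> A" for x n
    by (auto simp: D_def I_def below_top_def)
  have mem_U: "T x \<in> U n \<longleftrightarrow> (\<exists>i. below_top n i x) \<and> T x \<in> A" for x n
  proof -
    have "x \<in> level n i" if "T x \<in> level n (Suc i)" "Suc i < h n" for i
      using that T_image_level[OF that(2)] inj_T by (metis imageE injD)
    then show ?thesis using T_in_level by (auto simp: U_def I_def below_top_def)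
  qed
  have incD: "incseq D" unfolding incseq_Suc_iff using below_top_Suc by (fastforce simp: mem_D subset_eq)
  have U: "U n = T ` D n" for n
  proof (intro equalityI subsetI)
    fix y assume y: "y \<in> U n"
    obtain x where "y = T x" using surj_T by (metis surjD)
    then show "y \<in> T ` D n" using y mem_U mem_D by blast
  qed (use mem_U mem_D in auto)
  have incU: "incseq U" using incD by (auto simp: incseq_def U)
  have UD: "(\<Union>n. D n) = whole \<inter> T -` A" by (simp add: set_eq_iff mem_D whole_below_top)
  have "(\<Union>n. U n) = T ` (whole \<inter> T -` A)" unfolding U image_UN[symmetric] UD ..
  also have "\<dots> = T ` whole \<inter> A" by blast
  also have "\<dots> = (whole - {0}) \<inter> A" by (simp only: T_image_whole)
  finally have UU: "(\<Union>n. U n) = (whole - {0}) \<inter> A" .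
  have eq: "emeasure lborel (D n) = emeasure lborel (U n)" for n
  proof -
    have "emeasure lborel (D n) = (\<Sum>i\<in>I n. emeasure lborel (level n i \<inter> T -` A))"
      unfolding D_def by (rule emeasure_column_Int) (use I in auto)
    also have "\<dots> = (\<Sum>i\<in>I n. emeasure lborel (level n (Suc i) \<inter> A))"
    proof (rule sum.cong[OF refl])
      fix i assume "i \<in> I n"
      then have "level n i \<inter> T -` A = (\<lambda>x. x + shift n i) -` (level n (Suc i) \<inter> A)"
        using shift_level T_below_top by (auto simp: I_def below_top_def)
      then show "emeasure lborel (level n i \<inter> T -` A) = emeasure lborel (level n (Suc i) \<inter> A)"
        by (simp only:) (rule emeasure_lborel_translate, simp)
    qed
    also have "\<dots> = (\<Sum>i\<in>Suc ` I n. emeasure lborel (level n i \<inter> A))"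
      by (simp add: sum.reindex)
    also have "\<dots> = emeasure lborel (U n)"
      unfolding U_def by (rule emeasure_column_Int[symmetric]) (use I in \<open>auto simp: I_def\<close>)
    finally show ?thesis .
  qed
  have mD: "range D \<subseteq> sets lborel" and mU: "range U \<subseteq> sets lborel"
    using I(1) by (auto simp: D_def U_def intro!: sets.Int sets.finite_UN)
  have "emeasure lborel (whole \<inter> T -` A) = (SUP n. emeasure lborel (D n))"
    using SUP_emeasure_incseq[OF mD incD] UD by simp
  also have "\<dots> = emeasure lborel ((whole - {0}) \<inter> A)"
    unfolding eq using SUP_emeasure_incseq[OF mU incU] UU by simp
  also have "\<dots> = emeasure lborel (whole \<inter> A)"
  proof (rule emeasure_eq_AE)
    show "AE x in lborel. x \<in> (whole - {0}) \<inter> A \<longleftrightarrow> x \<in> whole \<inter> A"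
      using AE_lborel_singleton[of 0] by (rule eventually_mono) auto
  qed auto
  finally show ?thesis .
qed

lemma mp_system_M: "mp_system M T"
proof -
  have T: "T \<in> measurable M M" using T_measurable by (simp cong: measurable_cong_sets)
  have "distr M M T = M"
  proof (rule measure_eqI)
    fix A assume "A \<in> sets (distr M M T)"
    then have A: "A \<in> sets borel" by simp
    have "T -` A \<in> sets borel" using measurable_sets[OF T_measurable A] by simp
    then show "emeasure (distr M M T) A = emeasure M A"
      using A T by (simp add: emeasure_distr emeasure_M emeasure_whole_vimage)
  qed simp
  moreover have "standard_prob_space M"
    unfolding standard_prob_space_def
  proof (intro conjI exI[of _ euclidean])
    show "prob_space M" by (rule prob_space_M)
    show "completely_metrizable_space (euclidean :: real topology)"
      by (rule completely_metrizable_space_euclidean)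
    show "second_countable (euclidean :: real topology)"
    proof -
      obtain B :: "real set set" where "countable B" "topological_basis B"
        using ex_countable_basis by blast
      moreover have "\<exists>V\<in>B. x \<in> V \<and> V \<subseteq> U" if "open U" "x \<in> U" for U x
        by (rule topological_basisE[OF \<open>topological_basis B\<close> that]) (rule bexI, simp_all)
      moreover have "open V" if "V \<in> B" for V
        using topological_basis_open[OF \<open>topological_basis B\<close> that] .
      ultimately show ?thesis
        unfolding second_countable_def open_openin[symmetric] by (intro exI[of _ B]) simp
    qed
    show "sets M = sigma_sets (space M) {U. openin euclidean U}"
      by (simp add: borel_def)
  qed simp
  ultimately show ?thesis
    using bij_T T T_inv_measurable by (simp add: mp_system_def bij_betw_def bij_def cong: measurable_cong_sets)
qed

definition total :: real where
  "total = measure lborel whole"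

lemma emeasure_whole_eq: "emeasure lborel whole = ennreal total"
  unfolding total_def using emeasure_whole_fin(2) by (intro emeasure_eq_ennreal_measure) (simp add: top.not_eq_extremum)

lemma mass_le_total: "mass n \<le> total"
proof -
  have "ennreal (mass n) \<le> ennreal total"
    unfolding emeasure_column[symmetric] emeasure_whole_eq[symmetric]
    by (rule emeasure_mono) (auto simp: whole_def)
  then show ?thesis using mass_ge_1[of n] by (simp add: total_def)
qed

lemma total_le_2: "total \<le> 2"
proof -
  have "ennreal total \<le> ennreal 2" using emeasure_whole(2) by (simp add: emeasure_whole_eq)
  then show ?thesis by (subst (asm) ennreal_le_iff) auto
qed

lemma total_pos: "total > 0"
  using mass_le_total[of 0] mass_ge_1[of 0] by linarith

lemma measure_M: "A \<in> sets borel \<Longrightarrow> measure M A = measure lborel (whole \<inter> A) / total"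
  unfolding M_def total_def using emeasure_whole_fin by (intro measure_uniform_measure) auto

lemma measure_M_levels:
  assumes "I \<subseteq> {..<h n}"
  shows "measure M (\<Union>i\<in>I. level n i) = real (card I) * width n / total"
proof -
  have "finite I" using assms finite_subset by blast
  then have b: "(\<Union>i\<in>I. level n i) \<in> sets borel" by (intro sets.finite_UN) auto
  have "(\<Union>i\<in>I. level n i) \<subseteq> whole" using assms unfolding subset_eq in_whole_iff by blast
  then have "measure M (\<Union>i\<in>I. level n i) = measure lborel (\<Union>i\<in>I. level n i) / total"
    using measure_M[OF b] by (simp add: Int_absorb1)
  also have "measure lborel (\<Union>i\<in>I. level n i) = real (card I) * width n"
    using emeasure_levels[OF assms] width_pos[of n] by (simp add: measure_def)
  finally show ?thesis .
qed

section \<open>Verification of the rank one conditions\<close>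

lemma compl_column_borel [measurable]: "UNIV - column n \<in> sets borel"
  using sets.compl_sets[OF column_borel[of n]] by simp

lemma ae_eq_set_refl: "ae_eq_set N A A"
  by (simp add: ae_eq_set_def)

lemma tower_eq_column: "tower T (level n 0) (h n) = column n"
  unfolding tower_def column_def using T_funpow_level[of 0 _ n] by (intro SUP_cong) auto

lemma tower_partition_eq:
  "tower_partition M T (level n 0) (h n) = insert (UNIV - column n) (level n ` {..<h n})"
  unfolding tower_partition_def tower_eq_column space_M
  using T_funpow_level[of 0 _ n] by (intro arg_cong2[of _ _ _ _ insert] image_cong) auto

text \<open>Copies are numbered from 0 but pieces of the base from 1: piece \<open>i\<close> is the
  bottom of copy \<open>i - 1\<close>, and these are the spacers that follow that copy.\<close>

definition spacers :: "nat \<Rightarrow> nat \<Rightarrow> nat" where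
  "spacers n i = st n i - (st n (i - 1) + h n)"

lemma st_eq:
  assumes "l < q n"
  shows "st n l = l * h n + (\<Sum>i=1..l. spacers n i)"
  using assms
proof (induction l)
  case (Suc l)
  have "st n (Suc l) = st n l + h n + spacers n (Suc l)"
    using st_step[OF Suc.prems] by (simp add: spacers_def)
  then show ?case using Suc by simp
qed (simp add: st_0)

lemma h_Suc: "h (Suc n) = q n * h n + (\<Sum>i=1..q n - 1. spacers n i)"
proof -
  have "st n (q n - 1) = (q n - 1) * h n + (\<Sum>i=1..q n - 1. spacers n i)"
    using q_pos[of n] by (intro st_eq) simp
  moreover have "q n * h n = (q n - 1) * h n + h n"
    using q_pos[of n] by (cases "q n") auto
  ultimately show ?thesis using st_last[of n] by linarith
qed

lemma h_Suc_ge: "2 * h n \<le> h (Suc n)"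
proof -
  have "2 * h n \<le> q n * h n" using q_ge[of n] by (rule mult_le_mono1)
  then show ?thesis using h_Suc[of n] by linarith
qed

lemma h_ge: "2 ^ n \<le> h n"
proof (induction n)
  case (Suc n)
  then show ?case using h_Suc_ge[of n] by simp
qed (simp add: h_0)

lemma spacers_fraction: "real (\<Sum>i=1..q n - 1. spacers n i) / real (h (Suc n)) \<le> (1 / 2) ^ n"
proof -
  define s where "s = (\<Sum>i=1..q n - 1. spacers n i)"
  have hs: "h (Suc n) = q n * h n + s" by (simp only: h_Suc s_def)
  have "2 ^ (n + 2) * s \<le> q n * h n"
    using growth[of n] unfolding hs by (simp add: algebra_simps)
  also have "\<dots> \<le> h (Suc n)" by (simp add: hs)
  finally have "2 ^ n * s \<le> h (Suc n)" by simp
  then have "real (2 ^ n * s) \<le> real (h (Suc n))" by (simp only: of_nat_le_iff)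
  then have "real s / real (h (Suc n)) \<le> (1 / 2) ^ n"
    using h_pos[of "Suc n"] by (simp add: field_simps power_one_over)
  then show ?thesis by (simp only: s_def)
qed

lemma rank_one_params_h: "rank_one_params h q spacers"
  unfolding rank_one_params_def
proof (intro conjI allI impI)
  show "1 \<le> h 1" using h_pos[of 1] by simp
  show "1 \<le> q n" for n using q_pos[of n] by simp
  show "h (n + 1) = q n * h n + (\<Sum>i=1..q n - 1. spacers n i)" for n
    using h_Suc[of n] by simp
  have "h n < h (Suc n)" for n using h_Suc_ge[of n] h_pos[of n] by linarith
  then have "strict_mono h" by (rule strict_mono_Suc_iff[THEN iffD2, OF allI])
  then show "strict_mono_on {1..} h" by (simp add: strict_mono_on_def strict_mono_def)
  have "summable (\<lambda>n. (1 / 2 :: real) ^ (n + 1))"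
    by (intro summable_ignore_initial_segment summable_geometric) simp
  then show "summable (\<lambda>n. real (\<Sum>i=1..q (n + 1) - 1. spacers (n + 1) i) / real (h (n + 2)))"
  proof (rule summable_comparison_test')
    fix n :: nat
    have "real (\<Sum>i=1..q (n + 1) - 1. spacers (n + 1) i) / real (h (n + 2)) \<le> (1 / 2) ^ (n + 1)"
      using spacers_fraction[of "n + 1"] by simp
    moreover have "0 \<le> real (\<Sum>i=1..q (n + 1) - 1. spacers (n + 1) i) / real (h (n + 2))"
      by (intro divide_nonneg_nonneg of_nat_0_le_iff)
    ultimately show "norm (real (\<Sum>i=1..q (n + 1) - 1. spacers (n + 1) i) / real (h (n + 2))) \<le> (1 / 2) ^ (n + 1)"
      by (simp only: real_norm_def abs_of_nonneg)
  qed
qed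

text \<open>An open half-line meets \<open>whole\<close> in a union of levels: a point
  \<open>x < a\<close> lies in some level of width below \<open>a - x\<close>, which stays left of
  \<open>a\<close>. The complement of \<open>whole\<close> is null, so agreement on
  \<open>whole\<close> suffices.\<close>

lemma columns_generate:
  assumes B: "B \<in> sets borel"
  shows "\<exists>B'\<in>sigma_sets UNIV (\<Union>n\<in>{1..}. insert (UNIV - column n) (level n ` {..<h n})).
    B \<inter> whole = B' \<inter> whole"
proof -
  define G where "G = (\<Union>n\<in>{1..}. insert (UNIV - column n) (level n ` {..<h n}))"
  interpret G: sigma_algebra UNIV "sigma_sets UNIV G" by (rule sigma_algebra_sigma_sets) simp
  have lev: "level (Suc n) i \<in> sigma_sets UNIV G" if "i < h (Suc n)" for n i
  proof -
    have "level (Suc n) i \<in> G" unfolding G_def using that by (intro UN_I[of "Suc n"]) auto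
    then show ?thesis by (rule sigma_sets.Basic)
  qed
  have "B \<in> sigma_sets UNIV (range lessThan)"
    using B unfolding borel_Iio by simp
  then have "\<exists>B'\<in>sigma_sets UNIV G. B \<inter> whole = B' \<inter> whole"
  proof induction
    case (Basic S)
    then obtain a where S: "S = {..<a}" by auto
    \<comment> \<open>\<open>Suc n\<close> because the generating partitions start at stage
      1.\<close>
    define B' where "B' = (\<Union>n. \<Union>i\<in>{i. i < h (Suc n) \<and> level (Suc n) i \<subseteq> S}. level (Suc n) i)"
    have "B' \<in> sigma_sets UNIV G" unfolding B'_def
      by (rule G.countable_UN'', simp, rule G.countable_UN'') (auto intro: lev)
    moreover have "S \<inter> whole = B' \<inter> whole"
    proof (intro equalityI subsetI)
      fix x assume x: "x \<in> S \<inter> whole"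
      then obtain n i where n: "i < h n" "x \<in> level n i" by (auto simp: in_whole_iff)
      obtain m where m: "m \<ge> Suc n" "width m < a - x"
        using eventually_width_less[of "a - x" "Suc n"] x S by auto
      then have "n \<le> m" by simp
      then have "x \<in> column m" using column_mono[of n m] n by (auto simp: column_def)
      then obtain j where j: "j < h m" "x \<in> level m j" by (auto simp: column_def)
      have "level m j \<subseteq> S" using j(2) m(2) by (auto simp: level_def S)
      moreover obtain k where "m = Suc k" using m(1) by (cases m) auto
      ultimately show "x \<in> B' \<inter> whole" using j x unfolding B'_def by blast
    qed (auto simp: B'_def)
    ultimately show ?case by blast
  next
    case Empty
    then show ?case by (intro bexI[of _ "{}"]) auto
  next
    case (Compl S)
    then obtain B' where B': "B' \<in> sigma_sets UNIV G" "S \<inter> whole = B' \<inter> whole" by blast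
    then have "(UNIV - S) \<inter> whole = (UNIV - B') \<inter> whole" by blast
    then show ?case using sigma_sets.Compl[OF B'(1)] by blast
  next
    case (Union S)
    then have "\<forall>i. \<exists>B'\<in>sigma_sets UNIV G. S i \<inter> whole = B' \<inter> whole" by blast
    then obtain B' where B': "\<And>i. B' i \<in> sigma_sets UNIV G" "\<And>i. S i \<inter> whole = B' i \<inter> whole"
      by metis
    then have "(\<Union>i. S i) \<inter> whole = (\<Union>i. B' i) \<inter> whole" by blast
    then show ?case using sigma_sets.Union[of B' UNIV G] B'(1) by blast
  qed
  then show ?thesis by (simp only: G_def)
qed

lemma rank_one_system_M: "rank_one_system M T"
  unfolding rank_one_system_def
proof (rule conjI[OF mp_system_M], rule exI[of _ h], rule exI[of _ q], rule exI[of _ spacers],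
    rule exI[of _ "\<lambda>n. level n 0"], rule exI[of _ "\<lambda>n i. level (Suc n) (st n (i - 1))"],
    intro conjI)
  show "rank_one_params h q spacers" by (rule rank_one_params_h)
  show "\<forall>n\<ge>1. level n 0 \<in> sets M \<and> 0 < measure M (level n 0)"
  proof (intro allI impI conjI)
    fix n
    show "0 < measure M (level n 0)"
      using measure_M_levels[of "{0}" n] h_pos[of n] width_pos[of n] total_pos by simp
  qed simp
  show "\<forall>n\<ge>1. ae_disjoint_family_on M (\<lambda>i. (T ^^ i) ` level n 0) {..<h n}"
    unfolding ae_disjoint_family_on_def
  proof (intro allI impI ballI)
    fix n i j assume ij: "i \<in> {..<h n}" "j \<in> {..<h n}" "i \<noteq> j"
    then have "(T ^^ i) ` level n 0 = level n i" "(T ^^ j) ` level n 0 = level n j"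
      using T_funpow_level[of 0 i n] T_funpow_level[of 0 j n] by auto
    moreover have "level n i \<inter> level n j = {}"
      using level_disjoint[of i n j] ij by blast
    ultimately show "(T ^^ i) ` level n 0 \<inter> (T ^^ j) ` level n 0 \<in> null_sets M" by simp
  qed
  have st_less: "st n (i - 1) < h (Suc n)" if "i \<in> {1..q n}" for n i
    using copy_less[of "i - 1" n 0] that h_pos[of n] by auto
  show "\<forall>n\<ge>1. ae_partition M (level n 0) {1..q n} (\<lambda>i. level (Suc n) (st n (i - 1)))"
    unfolding ae_partition_def ae_disjoint_family_on_def
  proof (intro allI impI conjI ballI)
    fix n i j assume ij: "i \<in> {1..q n}" "j \<in> {1..q n}" "i \<noteq> j"
    have "i - 1 \<noteq> j - 1" "i - 1 < q n" "j - 1 < q n" using ij by auto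
    then have "st n (i - 1) \<noteq> st n (j - 1)"
      using is_copy_unique[of n "st n (i - 1)" "i - 1" 0 "j - 1" 0] h_pos[of n]
      by (auto simp: is_copy_def)
    then have "level (Suc n) (st n (i - 1)) \<inter> level (Suc n) (st n (j - 1)) = {}"
      using level_disjoint[OF st_less[OF ij(1)] st_less[OF ij(2)]] by blast
    then show "level (Suc n) (st n (i - 1)) \<inter> level (Suc n) (st n (j - 1)) \<in> null_sets M" by simp
  next
    fix n
    have "(\<Union>i\<in>{1..q n}. level (Suc n) (st n (i - 1))) = level n 0"
    proof (intro equalityI subsetI)
      fix x assume "x \<in> level n 0"
      then obtain l where "l < q n" "x \<in> level (Suc n) (st n l)"
        using in_level_copy[of x n 0] h_pos[of n] by auto
      then show "x \<in> (\<Union>i\<in>{1..q n}. level (Suc n) (st n (i - 1)))"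
        by (intro UN_I[of "Suc l"]) auto
    next
      fix x assume "x \<in> (\<Union>i\<in>{1..q n}. level (Suc n) (st n (i - 1)))"
      then obtain i where "i \<in> {1..q n}" "x \<in> level (Suc n) (st n (i - 1))" by blast
      moreover from calculation have "i - 1 < q n" by auto
      ultimately show "x \<in> level n 0" using level_copy_subset[of "i - 1" n 0] h_pos[of n] by auto
    qed
    then show "ae_eq_set M (\<Union>i\<in>{1..q n}. level (Suc n) (st n (i - 1))) (level n 0)"
      by (simp only: ae_eq_set_refl)
  qed auto
  show "\<forall>n\<ge>1. \<forall>i\<in>{1..q n - 1}. ae_eq_set M
      ((T ^^ (h n + spacers n i)) ` level (Suc n) (st n (i - 1))) (level (Suc n) (st n (i + 1 - 1)))"
  proof (intro allI impI ballI)
    fix n i assume i: "i \<in> {1..q n - 1}"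
    then have "Suc (i - 1) = i" "Suc (i - 1) < q n" by auto
    then have s: "st n (i - 1) + (h n + spacers n i) = st n i"
      using st_step[of "i - 1" n] by (simp add: spacers_def)
    have "st n i < h (Suc n)" using st_less[of "Suc i" n] i by auto
    then have "(T ^^ (h n + spacers n i)) ` level (Suc n) (st n (i - 1)) = level (Suc n) (st n i)"
      using T_funpow_level[of "st n (i - 1)" "h n + spacers n i" "Suc n"] s by simp
    then show "ae_eq_set M ((T ^^ (h n + spacers n i)) ` level (Suc n) (st n (i - 1)))
        (level (Suc n) (st n (i + 1 - 1)))"
      by (simp add: ae_eq_set_refl)
  qed
  show "\<forall>n\<ge>1. ae_eq_set M (level (n + 1) 0) (level (Suc n) (st n (1 - 1)))"
    by (simp add: st_0 ae_eq_set_refl)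
  show "\<forall>n\<ge>1. ae_refines M (tower_partition M T (level (n + 1) 0) (h (n + 1)))
      (tower_partition M T (level n 0) (h n))"
    unfolding tower_partition_eq ae_refines_def
  proof (intro allI impI ballI)
    fix n C assume "C \<in> insert (UNIV - column (n + 1)) (level (n + 1) ` {..<h (n + 1)})"
    then have "\<exists>D\<in>insert (UNIV - column n) (level n ` {..<h n}). C \<subseteq> D"
    proof
      assume "C = UNIV - column (n + 1)"
      then have "C \<subseteq> UNIV - column n" using column_mono[of n "n + 1"] by auto
      then show ?thesis by (rule bexI) simp
    next
      assume "C \<in> level (n + 1) ` {..<h (n + 1)}"
      then obtain i where i: "i < h (n + 1)" "C = level (n + 1) i" by auto
      have "C \<inter> column n = {} \<or> (\<exists>p<h n. C \<subseteq> level n p)"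
        using level_refine[of n "n + 1" i] i by simp
      then show ?thesis
      proof
        assume "C \<inter> column n = {}"
        then have "C \<subseteq> UNIV - column n" by auto
        then show ?thesis by (rule bexI) simp
      next
        assume "\<exists>p<h n. C \<subseteq> level n p"
        then obtain p where "p < h n" "C \<subseteq> level n p" by auto
        then show ?thesis by (intro bexI[of _ "level n p"]) auto
      qed
    qed
    then obtain D where D: "D \<in> insert (UNIV - column n) (level n ` {..<h n})" "C \<subseteq> D" by blast
    then have "C - D = {}" by blast
    then have "C - D \<in> null_sets M" by (metis null_sets.empty_sets)
    then show "\<exists>D\<in>insert (UNIV - column n) (level n ` {..<h n}). C - D \<in> null_sets M"
      using D(1) by (rule bexI)
  qed
  show "ae_generates M (\<Union>n\<in>{1..}. tower_partition M T (level n 0) (h n))"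
    unfolding tower_partition_eq ae_generates_def space_M
  proof
    fix B assume "B \<in> sets M"
    then have B: "B \<in> sets borel" by simp
    let ?G = "\<Union>n\<in>{1..}. insert (UNIV - column n) (level n ` {..<h n})"
    obtain B' where B': "B' \<in> sigma_sets UNIV ?G" "B \<inter> whole = B' \<inter> whole"
      using columns_generate[OF B] by blast
    have "?G \<subseteq> sets borel"
    proof
      fix C assume "C \<in> ?G"
      then obtain n where "C = UNIV - column n \<or> C \<in> level n ` {..<h n}" by blast
      then show "C \<in> sets borel"
      proof
        assume "C = UNIV - column n"
        then show ?thesis using compl_column_borel by simp
      next
        assume "C \<in> level n ` {..<h n}"
        then obtain i where "C = level n i" by blast
        then show ?thesis by simp
      qed
    qed
    then have "sigma_sets UNIV ?G \<subseteq> sets borel"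
      using sets.sigma_sets_subset[of ?G borel] by (simp only: space_borel)
    then have B'b: "B' \<in> sets borel" using B'(1) by (rule subsetD)
    have diff: "(B - B') \<union> (B' - B) \<in> sets borel" using B B'b by (intro sets.Un sets.Diff)
    have disj: "whole \<inter> ((B - B') \<union> (B' - B)) = {}" using B'(2) by blast
    have "emeasure M ((B - B') \<union> (B' - B)) = 0"
      unfolding emeasure_M[OF diff] disj by simp
    then have "(B - B') \<union> (B' - B) \<in> null_sets M"
      by (rule null_setsI) (simp only: sets_M diff)
    then have "ae_eq_set M B B'" unfolding ae_eq_set_def .
    then show "\<exists>B'\<in>sigma_sets UNIV ?G. ae_eq_set M B B'" using B'(1) by (rule bexI)
  qed
qed

section \<open>Sequence entropy of the constructed system\<close>

text \<open>Indices start at 1 because \<open>seq_entropy\<close> ranges over families on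
  \<open>{1..m}\<close>; index \<open>h n + 1\<close> is the remainder.\<close>

definition cell :: "nat \<Rightarrow> nat \<Rightarrow> real set" where
  "cell n j = (if j \<le> h n then level n (j - 1) else UNIV - column n)"

lemma cell_borel [measurable]: "cell n j \<in> sets borel"
  using compl_column_borel[of n] by (simp add: cell_def)

lemma cell_disjoint:
  assumes "i \<in> {1..h n + 1}" "j \<in> {1..h n + 1}" "x \<in> cell n i" "x \<in> cell n j"
  shows "i = j"
proof -
  have c: "i \<le> h n \<and> x \<in> level n (i - 1) \<and> x \<in> column n \<or> i = h n + 1 \<and> x \<notin> column n"
    if "i \<in> {1..h n + 1}" "x \<in> cell n i" for i
    using that by (fastforce simp: cell_def column_def split: if_splits)
  have "i - 1 = j - 1" if "x \<in> column n"
    using c[OF assms(1,3)] c[OF assms(2,4)] that assms(1,2) level_disjoint[of "i - 1" n "j - 1" x] by auto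
  then show ?thesis using c[OF assms(1,3)] c[OF assms(2,4)] assms(1,2) by force
qed

lemma cell_cover: "(\<Union>j\<in>{1..h n + 1}. cell n j) = UNIV"
proof -
  have "x \<in> (\<Union>j\<in>{1..h n + 1}. cell n j)" for x
  proof (cases "x \<in> column n")
    case True
    then obtain i where "i < h n" "x \<in> level n i" by (auto simp: column_def)
    then show ?thesis by (intro UN_I[of "Suc i"]) (auto simp: cell_def)
  next
    case False
    then show ?thesis by (intro UN_I[of "h n + 1"]) (auto simp: cell_def)
  qed
  then show ?thesis by auto
qed

lemma ae_partition_cell: "ae_partition M (space M) {1..h n + 1} (cell n)"
  unfolding ae_partition_def ae_disjoint_family_on_def
proof (intro conjI ballI impI)
  fix i j assume "i \<in> {1..h n + 1}" "j \<in> {1..h n + 1}" "i \<noteq> j"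
  then have "cell n i \<inter> cell n j = {}" using cell_disjoint by blast
  then show "cell n i \<inter> cell n j \<in> null_sets M" by simp
next
  show "ae_eq_set M (\<Union>j\<in>{1..h n + 1}. cell n j) (space M)"
    unfolding cell_cover space_M by (rule ae_eq_set_refl)
qed auto

lemma level_subset_cell:
  assumes "n \<le> m" "p < h m" "x \<in> level m p" "x \<in> cell n j" "j \<in> {1..h n + 1}"
  shows "level m p \<subseteq> cell n j"
proof (cases "level m p \<inter> column n = {}")
  case True
  then have "x \<notin> column n" using assms(3) by blast
  then have "\<not> j \<le> h n" using assms(4,5) by (auto simp: cell_def column_def)
  then show ?thesis using True by (auto simp: cell_def)
next
  case False
  then obtain p' where p': "p' < h n" "level m p \<subseteq> level n p'"
    using level_refine[OF assms(1,2)] by blast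
  then have "x \<in> cell n (Suc p')" using assms(3) by (auto simp: cell_def)
  then have "j = Suc p'" using cell_disjoint[of j n "Suc p'" x] assms(4,5) p'(1) by auto
  then show ?thesis using p' by (simp add: cell_def)
qed

text \<open>A single level is small because \<open>h n\<close> is at least \<open>2 ^ n\<close>; the
  remainder is small because the spacers added after stage \<open>n\<close> have total length at
  most \<open>(1 / 2) ^ n\<close> while \<open>mass m\<close> is at least 1. Dividing by
  \<open>width m\<close> turns lengths into numbers of levels.\<close>

lemma card_levels_in_cell:
  assumes nm: "n \<le> m" and j: "j \<in> {1..h n + 1}"
  shows "real (card {p. p < h m \<and> level m p \<subseteq> cell n j}) \<le> (1 / 2) ^ n * real (h m)"
proof -
  let ?E = "{p. p < h m \<and> level m p \<subseteq> cell n j}"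
  have E: "?E \<subseteq> {..<h m}" by auto
  have "emeasure lborel (\<Union>p\<in>?E. level m p) \<le> ennreal ((1 / 2) ^ n * mass m)"
  proof (cases "j \<le> h n")
    case True
    have "emeasure lborel (\<Union>p\<in>?E. level m p) \<le> emeasure lborel (level n (j - 1))"
      using True by (intro emeasure_mono) (auto simp: cell_def)
    also have "\<dots> = ennreal (width n)" by (rule emeasure_level)
    also have "\<dots> \<le> ennreal ((1 / 2) ^ n * mass m)"
    proof (rule ennreal_leI)
      have "2 ^ n * width n \<le> real (h n) * width n"
        using h_ge[of n] width_pos[of n] by (intro mult_right_mono) (simp_all flip: of_nat_le_iff)
      also have "\<dots> \<le> mass m" using mass_mono[OF nm] by (simp add: mass_def)
      finally show "width n \<le> (1 / 2) ^ n * mass m" by (simp add: field_simps power_one_over)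
    qed
    finally show ?thesis .
  next
    case False
    have "emeasure lborel (\<Union>p\<in>?E. level m p) \<le> emeasure lborel (column m - column n)"
      using False by (intro emeasure_mono) (auto simp: cell_def column_def)
    also have "\<dots> = ennreal (mass m) - ennreal (mass n)"
      using column_mono[OF nm] by (subst emeasure_Diff) (auto simp: emeasure_column)
    also have "\<dots> = ennreal (mass m - mass n)" using mass_nonneg by (rule ennreal_minus)
    also have "\<dots> \<le> ennreal ((1 / 2) ^ n * mass m)"
    proof (rule ennreal_leI)
      have "(1 / 2 :: real) ^ n * 1 \<le> (1 / 2) ^ n * mass m"
        using mass_ge_1[of m] by (intro mult_left_mono) auto
      then show "mass m - mass n \<le> (1 / 2) ^ n * mass m" using mass_diff_le[OF nm] by linarith
    qed
    finally show ?thesis .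
  qed
  then have "ennreal (real (card ?E) * width m) \<le> ennreal ((1 / 2) ^ n * mass m)"
    by (simp only: emeasure_levels[OF E])
  then have "real (card ?E) * width m \<le> (1 / 2) ^ n * mass m"
    using mass_nonneg[of m] by (subst (asm) ennreal_le_iff) auto
  then have "real (card ?E) * width m \<le> ((1 / 2) ^ n * real (h m)) * width m" by (simp add: mass_def)
  then show ?thesis using width_pos[of m] by (rule mult_right_le_imp_le)
qed

text \<open>A word prescribes a cell at every time in \<open>K\<close>, hence a set
  \<open>E k\<close> of levels of column \<open>m\<close>. A level of column \<open>m + 1\<close>
  with index in \<open>Y\<close> that meets the join cell must satisfy all these conditions, and few
  do. This holds for every word, so \<open>part_entropy_ge\<close> applies with p = 2^(-n card K /
  2).\<close>

lemma part_entropy_seq_join_ge: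
  assumes nm: "n \<le> m" and K: "K \<subseteq> {1..N}" and Y: "Y \<subseteq> {..<h (Suc m)}"
    and inside: "\<And>i k. i \<in> Y \<Longrightarrow> k \<in> K \<Longrightarrow> i + t k < h (Suc m)"
    and big: "h (Suc m) \<le> 8 * card Y"
    and hits: "\<And>(\<delta> :: real) E. 0 < \<delta> \<Longrightarrow> \<delta> \<le> 1 \<Longrightarrow>
      (\<And>k. k \<in> K \<Longrightarrow> finite (E k) \<and> real (card (E k)) \<le> \<delta> * h m) \<Longrightarrow>
      real (card {i \<in> Y. \<forall>k\<in>K. \<forall>l p. l < q m \<longrightarrow> p < h m \<longrightarrow> i + t k = st m l + p \<longrightarrow> p \<in> E k})
      \<le> \<delta> powr (card K / 2) * h (Suc m)"
  shows "(real n * real (card K) / 2 * ln 2 - ln 32) / 32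
    \<le> part_entropy M ({1..N} \<rightarrow>\<^sub>E {1..h n + 1}) (seq_join M T t (cell n) N)"
proof -
  define p where "p = ((1 / 2) ^ n :: real) powr (card K / 2)"
  have p: "p > 0" by (simp add: p_def)
  define YY where "YY = (\<Union>i\<in>Y. level (Suc m) i)"
  have finY: "finite Y" using Y finite_subset by blast
  have mY: "YY \<in> sets borel" unfolding YY_def using finY by (intro sets.finite_UN) auto
  have T_pow: "(T ^^ k) \<in> borel_measurable borel" for k
    by (rule measurable_compose_n[OF T_measurable])
  let ?A = "seq_join M T t (cell n) N"
  have mA: "?A w \<in> sets M" for w
  proof -
    have "?A w = (\<Inter>k\<in>{1..N}. (T ^^ t k) -` cell n (w k) \<inter> space M) \<inter> space M"
      by (auto simp: seq_join_def)
    moreover have "(T ^^ t k) -` cell n (w k) \<inter> space M \<in> sets M" for k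
      using measurable_sets[OF T_pow cell_borel] by simp
    ultimately show ?thesis
      by (cases "N = 0") (auto intro!: sets.finite_INT)
  qed
  \<comment> \<open>1/32 is half of a lower bound for \<open>measure M YY\<close>: \<open>Y\<close>
    holds at least an eighth of the levels, the column has mass at least 1, and
    \<open>total \<le> 2\<close>.\<close>
  have "1 / 32 * ln (1 / 32 / p) \<le> part_entropy M ({1..N} \<rightarrow>\<^sub>E {1..h n + 1}) ?A"
  proof (rule part_entropy_ge)
    show "prob_space M" by (rule prob_space_M)
    show "finite ({1..N} \<rightarrow>\<^sub>E {1..h n + 1})" by (intro finite_PiE) auto
    show "?A w \<in> sets M" for w by (rule mA)
    show "YY \<in> sets M" using mY by simp
    show "YY \<subseteq> (\<Union>w\<in>{1..N} \<rightarrow>\<^sub>E {1..h n + 1}. ?A w)"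
    proof
      fix x
      have "\<exists>j\<in>{1..h n + 1}. (T ^^ t k) x \<in> cell n j" for k
        using cell_cover[of n] by blast
      then obtain f where f: "\<And>k. f k \<in> {1..h n + 1}" "\<And>k. (T ^^ t k) x \<in> cell n (f k)" by metis
      have "restrict f {1..N} \<in> {1..N} \<rightarrow>\<^sub>E {1..h n + 1}" using f(1) by auto
      moreover have "x \<in> ?A (restrict f {1..N})" using f(2) by (auto simp: seq_join_def)
      ultimately show "x \<in> (\<Union>w\<in>{1..N} \<rightarrow>\<^sub>E {1..h n + 1}. ?A w)" by blast
    qed
    show "ae_disjoint_family_on M ?A ({1..N} \<rightarrow>\<^sub>E {1..h n + 1})"
      unfolding ae_disjoint_family_on_def
    proof (intro ballI impI)
      fix w w' assume w: "w \<in> {1..N} \<rightarrow>\<^sub>E {1..h n + 1}" "w' \<in> {1..N} \<rightarrow>\<^sub>E {1..h n + 1}" "w \<noteq> w'"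
      have "?A w \<inter> ?A w' = {}"
      proof (rule equals0I)
        fix x assume x: "x \<in> ?A w \<inter> ?A w'"
        have "w k = w' k" if k: "k \<in> {1..N}" for k
          using cell_disjoint[of "w k" n "w' k" "(T ^^ t k) x"] PiE_mem[OF w(1) k] PiE_mem[OF w(2) k] x k
          by (auto simp: seq_join_def)
        then show False using w by (metis PiE_ext)
      qed
      then show "?A w \<inter> ?A w' \<in> null_sets M" by simp
    qed
    show "0 < p" by (rule p)
    show "2 * (1 / 32) \<le> measure M YY"
    proof -
      have "real (h (Suc m)) \<le> 8 * real (card Y)" using big by linarith
      then have "real (h (Suc m)) * width (Suc m) \<le> 8 * real (card Y) * width (Suc m)"
        using width_pos[of "Suc m"] by (intro mult_right_mono) auto
      then have "1 \<le> 8 * (real (card Y) * width (Suc m))"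
        using mass_ge_1[of "Suc m"] by (simp add: mass_def del: width.simps)
      then have "total / 16 \<le> real (card Y) * width (Suc m)" using total_le_2 by linarith
      then show ?thesis
        unfolding YY_def measure_M_levels[OF Y] using total_pos by (simp add: field_simps del: width.simps)
    qed
    fix w assume w: "w \<in> {1..N} \<rightarrow>\<^sub>E {1..h n + 1}"
    define E where "E k = {p. p < h m \<and> level m p \<subseteq> cell n (w k)}" for k
    define Z where "Z = {i \<in> Y. \<forall>k\<in>K. \<forall>l p. l < q m \<longrightarrow> p < h m \<longrightarrow> i + t k = st m l + p \<longrightarrow> p \<in> E k}"
    have wk: "w k \<in> {1..h n + 1}" if "k \<in> K" for k using w K that by (auto dest: PiE_mem)
    have "real (card Z) \<le> p * real (h (Suc m))"
      unfolding Z_def p_def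
    proof (rule hits[of "(1 / 2) ^ n" E])
      fix k assume "k \<in> K"
      then show "finite (E k) \<and> real (card (E k)) \<le> (1 / 2) ^ n * real (h m)"
        using card_levels_in_cell[OF nm wk] by (simp add: E_def)
    qed (auto intro: power_le_one)
    then have "real (card Z) * width (Suc m) \<le> p * real (h (Suc m)) * width (Suc m)"
      using width_pos[of "Suc m"] by (intro mult_right_mono) auto
    also have "\<dots> = p * mass (Suc m)" by (simp add: mass_def del: width.simps)
    also have "\<dots> \<le> p * total" using mass_le_total p by (intro mult_left_mono) auto
    finally have Zp: "real (card Z) * width (Suc m) / total \<le> p"
      using total_pos by (simp add: field_simps del: width.simps)
    have Z: "Z \<subseteq> {..<h (Suc m)}" using Y by (auto simp: Z_def)
    have "YY \<inter> ?A w \<subseteq> (\<Union>i\<in>Z. level (Suc m) i)"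
    proof
      fix x assume x: "x \<in> YY \<inter> ?A w"
      then obtain i where i: "i \<in> Y" "x \<in> level (Suc m) i" by (auto simp: YY_def)
      have "p \<in> E k" if k: "k \<in> K" and l: "l < q m" "p < h m" and e: "i + t k = st m l + p" for k l p
      proof -
        have "(T ^^ t k) x \<in> level (Suc m) (i + t k)"
          using T_funpow_level[OF inside[OF i(1) k]] i(2) by blast
        then have 1: "(T ^^ t k) x \<in> level m p" using level_copy_subset[OF l] e by auto
        have "(T ^^ t k) x \<in> cell n (w k)" using x k K by (auto simp: seq_join_def)
        then show ?thesis using level_subset_cell[OF nm l(2) 1 _ wk[OF k]] l(2) by (simp add: E_def)
      qed
      then have "i \<in> Z" using i(1) by (simp add: Z_def)
      then show "x \<in> (\<Union>i\<in>Z. level (Suc m) i)" using i(2) by blast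
    qed
    moreover have "finite Z" using finY by (simp add: Z_def)
    ultimately have "measure M (YY \<inter> ?A w) \<le> measure M (\<Union>i\<in>Z. level (Suc m) i)"
      using prob_space.finite_measure[OF prob_space_M] mA mY
      by (intro finite_measure.finite_measure_mono) (auto intro: sets.finite_UN)
    then show "measure M (YY \<inter> ?A w) \<le> p" using measure_M_levels[OF Z] Zp by linarith
  qed simp
  moreover have "ln p = - (real n * real (card K) / 2 * ln 2)"
    by (simp add: p_def ln_powr ln_realpow ln_div)
  ultimately show ?thesis using p by (simp add: ln_div ln_mult field_simps)
qed

end

section \<open>Choice of the parameters and conclusion\<close>

lemma limsup_ge_frequently:
  fixes u :: "nat \<Rightarrow> ereal"
  assumes "\<And>m. \<exists>N\<ge>m. c \<le> u N"
  shows "c \<le> limsup u"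
  unfolding limsup_INF_SUP
proof (rule INF_greatest)
  fix m
  obtain N where "N \<ge> m" "c \<le> u N" using assms by blast
  then show "c \<le> Sup (u ` {m..})" by (intro SUP_upper2[of N]) auto
qed

text \<open>\<open>N\<close>, \<open>K\<close> and \<open>Y\<close> are hidden behind quantifiers so
  that \<open>B\<close> is the only choice entering the recursion for the heights. The condition
  \<open>N \<ge> m\<close> makes late stages supply arbitrarily large \<open>N\<close> for one fixed
  partition.\<close>

definition good_stage :: "(nat \<Rightarrow> nat) \<Rightarrow> real \<Rightarrow> nat \<Rightarrow> nat \<Rightarrow> nat \<Rightarrow> nat \<Rightarrow> bool" where
  "good_stage t d m h L B \<longleftrightarrow> B > 0 \<and> (\<exists>N\<ge>m. \<exists>K\<subseteq>{1..N}. N > 0 \<and> d * real N \<le> real (card K) \<and>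
    (\<exists>Y. independent_positions t K h L B Y))"

lemma ex_good_stage:
  assumes d: "d > 0" and sparse: "\<forall>G m. \<exists>N\<ge>m. \<exists>K\<subseteq>{1..N}. N > 0 \<and> d * real N \<le> real (card K)
      \<and> (\<forall>k\<in>K. \<forall>k'\<in>K. k < k' \<longrightarrow> t k + G \<le> t k')"
    and h: "h > 0" and L: "L \<ge> 7"
  shows "\<exists>B. good_stage t d m h L B"
proof -
  obtain N K where N: "N \<ge> m" "K \<subseteq> {1..N}" "N > 0" "d * real N \<le> real (card K)"
    and gap: "\<forall>k\<in>K. \<forall>k'\<in>K. k < k' \<longrightarrow> t k + block_len h L \<le> t k'"
    using sparse by meson
  have finK: "finite K" using N(2) finite_subset by blast
  have "d * real N > 0" using d N(3) by simp
  then have "K \<noteq> {}" using N(4) by auto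
  \<comment> \<open>One more than the sum exceeds every \<open>t k\<close>, and a block has length
    at least 1.\<close>
  define B' where "B' = Suc (\<Sum>k\<in>K. t k)"
  have "t k < B' * block_len h L" if "k \<in> K" for k
  proof -
    have "t k < B'" using member_le_sum[OF that, of t] finK by (simp add: B'_def)
    also have "B' * 1 \<le> B' * block_len h L" using h by (intro mult_le_mono2) (simp add: block_len_def)
    finally show ?thesis by simp
  qed
  moreover have "B' > 0" by (simp add: B'_def)
  moreover have "t k + block_len h L \<le> t k'" if "k \<in> K" "k' \<in> K" "k < k'" for k k'
    using gap that by blast
  ultimately have Y: "\<exists>Y. independent_positions t K h L (2 * B') Y"
    by (intro many_independent_positions[OF h L finK \<open>K \<noteq> {}\<close> refl])
  have "good_stage t d m h L (2 * B')"
    unfolding good_stage_def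
  proof (rule conjI)
    show "2 * B' > 0" by (simp add: B'_def)
  qed (rule exI[of _ N], rule conjI[OF N(1)], rule exI[of _ K], rule conjI[OF N(2)],
      rule conjI[OF N(3)], rule conjI[OF N(4)], rule Y)
  then show ?thesis by blast
qed

theorem corollary1p5:
  fixes t :: "nat \<Rightarrow> nat"
  assumes "strict_mono_on {1..} t"
    and "\<forall>n\<ge>1. t n > 0"
    and "dilates_on_positive_lower_density t"
  shows "\<exists>(M :: real measure) T. rank_one_system M T \<and> seq_entropy M T t = \<infinity>"
proof -
  obtain d where d: "d > 0" and sparse: "\<forall>G m. \<exists>N\<ge>m. \<exists>K\<subseteq>{1..N}. N > 0 \<and> d * real N \<le> real (card K)
      \<and> (\<forall>k\<in>K. \<forall>k'\<in>K. k < k' \<longrightarrow> t k + G \<le> t k')"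
    using sparse_times[OF assms(3)] by blast
  \<comment> \<open>At least 8, as the averaging needs, and growing so fast that the relative
    enlargement \<open>1 / L n\<close> meets \<open>growth\<close> with a factor 2 to spare.\<close>
  define L where "L n = (2 :: nat) ^ (n + 3)" for n
  have L: "L n \<ge> 7" "L n > 0" for n
  proof -
    have "(2 :: nat) ^ n \<ge> 1" by simp
    then have "8 \<le> L n" by (simp add: L_def power_add)
    then show "L n \<ge> 7" "L n > 0" by simp_all
  qed
  \<comment> \<open>The choice is a function of the stage and of an arbitrary height, because the
    actual heights are defined by recursion from these choices.\<close>
  define blocks where "blocks n h = (SOME B. good_stage t d n h (L n) B)" for n h
  have stage: "good_stage t d n h (L n) (blocks n h)" if "h > 0" for n h
    unfolding blocks_def using ex_good_stage[OF d sparse that L(1)] by (rule someI_ex)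
  define h where "h = rec_nat 1 (\<lambda>n h. next_height h (L n) (blocks n h))"
  have h0: "h 0 = 1" and hS: "h (Suc n) = next_height (h n) (L n) (blocks n (h n))" for n
    by (simp_all add: h_def)
  have h: "h n > 0" for n
    by (induction n) (simp_all add: h0 hS next_height_def)
  define B where "B n = blocks n (h n)" for n
  have stage: "good_stage t d n (h n) (L n) (B n)" for n
    unfolding B_def by (rule stage[OF h])
  have B: "B n > 0" for n using stage[of n] by (simp add: good_stage_def)
  interpret cut_and_stack h "\<lambda>n. copy_count (h n) (L n) (B n)" "\<lambda>n. copy_start (h n) (L n) (B n)"
  proof
    show "h 0 = 1" by (rule h0)
    fix n l
    show "2 \<le> copy_count (h n) (L n) (B n)" by (simp add: copy_count_def)
    show "copy_start (h n) (L n) (B n) 0 = 0" by simp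
    show "copy_start (h n) (L n) (B n) l + h n \<le> copy_start (h n) (L n) (B n) (Suc l)"
      by (rule copy_start_step[OF h L(2)])
    show "copy_start (h n) (L n) (B n) (copy_count (h n) (L n) (B n) - 1) + h n = h (Suc n)"
      using copy_start_last[OF L(2) B] by (simp add: hS B_def)
    have "L n * h (Suc n) \<le> (L n + 1) * (copy_count (h n) (L n) (B n) * h n)"
      using next_height_le[OF L(2)] by (simp add: hS B_def)
    moreover have "L n = 2 * 2 ^ (n + 2)" by (simp add: L_def power_add)
    moreover have "a * x \<le> (a + 1) * y" if "2 * a * x \<le> (2 * a + 1) * y" for a x y :: nat
      using that by (simp add: algebra_simps)
    ultimately show "2 ^ (n + 2) * h (Suc n) \<le> (2 ^ (n + 2) + 1) * (copy_count (h n) (L n) (B n) * h n)"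
      by (simp only:)
  qed
  have ent: "ereal (real n * d * ln 2 / 64 - 1) \<le> seq_entropy_part M T t {1..h n + 1} (cell n)" for n
    unfolding seq_entropy_part_def
  proof (rule limsup_ge_frequently)
    fix m0
    \<comment> \<open>\<open>m \<ge> n\<close> lets column \<open>m\<close> resolve the partition of
      column \<open>n\<close>; \<open>m \<ge> m0\<close> gives \<open>N \<ge> m0\<close>.\<close>
    define m where "m = max n m0"
    obtain N K Y where N: "N \<ge> m" "K \<subseteq> {1..N}" "N > 0" "d * real N \<le> real (card K)"
      and Y: "\<forall>i\<in>Y. \<forall>k\<in>K. i + t k < h (Suc m)" "Y \<subseteq> {..<h (Suc m)}" "h (Suc m) \<le> 8 * card Y"
      and hits: "\<forall>(\<delta> :: real) (E :: nat \<Rightarrow> nat set). 0 < \<delta> \<longrightarrow> \<delta> \<le> 1 \<longrightarrow>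
        (\<forall>k\<in>K. finite (E k) \<and> real (card (E k)) \<le> \<delta> * h m) \<longrightarrow>
        real (card {i \<in> Y. \<forall>k\<in>K. \<forall>l p. l < copy_count (h m) (L m) (B m) \<longrightarrow> p < h m \<longrightarrow>
          i + t k = copy_start (h m) (L m) (B m) l + p \<longrightarrow> p \<in> E k}) \<le> \<delta> powr (card K / 2) * h (Suc m)"
      using stage[of m] unfolding good_stage_def independent_positions_def hS[of m, folded B_def, symmetric]
      by (elim exE conjE) (rule that; assumption)
    have "(real n * real (card K) / 2 * ln 2 - ln 32) / 32
      \<le> part_entropy M ({1..N} \<rightarrow>\<^sub>E {1..h n + 1}) (seq_join M T t (cell n) N)" (is "_ \<le> ?e")
      by (rule part_entropy_seq_join_ge[of n m K N Y t]) (use N Y hits in \<open>auto simp: m_def\<close>)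
    moreover have "real n * d * real N / 2 * ln 2 \<le> real n * real (card K) / 2 * ln 2"
      using N(4) by (intro mult_right_mono divide_right_mono) (simp_all add: mult_left_mono mult.assoc)
    \<comment> \<open>After division by 32 the error is at most 31/32, hence below \<open>N\<close>:
      this is the \<open>- 1\<close> of the bound, and 64 is 2 times 32.\<close>
    moreover have "ln (32 :: real) \<le> 31" using ln_le_minus_one[of "32 :: real"] by simp
    moreover have "1 \<le> real N" using N(3) by simp
    ultimately have "(real n * d * ln 2 / 64 - 1) * real N \<le> ?e" by (simp add: algebra_simps)
    then have "real n * d * ln 2 / 64 - 1 \<le> ?e / real N" using N(3) by (simp add: field_simps)
    then show "\<exists>N\<ge>m0. ereal (real n * d * ln 2 / 64 - 1)
        \<le> ereal (part_entropy M ({1..N} \<rightarrow>\<^sub>E {1..h n + 1}) (seq_join M T t (cell n) N) / real N)"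
      using N(1) by (intro exI[of _ N]) (auto simp: m_def)
  qed
  have "seq_entropy M T t = \<infinity>"
  proof (rule ereal_top)
    fix C :: real
    have "d * ln 2 / 64 > 0" using d by simp
    then obtain n :: nat where "C + 1 \<le> real n * (d * ln 2 / 64)"
      using reals_Archimedean3 less_imp_le by blast
    then have "ereal C \<le> ereal (real n * d * ln 2 / 64 - 1)" by simp
    also have "\<dots> \<le> seq_entropy_part M T t {1..h n + 1} (cell n)" by (rule ent)
    also have "\<dots> \<le> seq_entropy M T t"
      unfolding seq_entropy_def
      by (rule SUP_upper2[of "(h n + 1, cell n)"]) (simp_all add: ae_partition_cell[simplified])
    finally show "ereal C \<le> seq_entropy M T t" .
  qed
  then show ?thesis using rank_one_system_M by blast
qed

end
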